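(* Let $\Omega\subset\mathbb{R}^2$ be a bounded, simply connected open set containing the origin $O$, let $\boldsymbol{E}\in\mathcal{A}(\Omega,\mathrm{Sym})$ be a singular strain field, and let $N\in\mathcal{A}(\Omega)$ be an incompatibility field. The incompatibility equation $\operatorname{Curl}\operatorname{Curl}\boldsymbol{E}=N$ (in the sense of distributions on $\Omega$) is equivalent to the following conditions together: (i) $\operatorname{curl}\operatorname{curl}(\boldsymbol{E}|_{\Omega-O})=N|_{\Omega-O}$ on $\Omega-O$; (ii) $\boldsymbol{E}(\mathbb{A}\nabla^2w^\alpha)=N(w^\alpha)$ for all multi-indices $\alpha\in\mathbb{N}^2$ with $|\alpha|\le\deg(\boldsymbol{E})+2$; (iii) $\deg(N)\le\deg(\boldsymbol{E})+2$. Here, for each multi-index $\alpha$, $w^\alpha\in\mathcal{D}(\Omega)$ is a compactly supported smooth function such that for every multi-index $\beta$, $\partial^\beta w^\alpha(O)=(-1)^{|\alpha|}$ if $\beta=\alpha$ and $\partial^\beta w^\alpha(O)=0$ if $\beta\ne\alpha$.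
   Context: $\Omega-O$ means $\Omega\setminus\{O\}$; $\mathrm{Sym}$ is the space of symmetric linear maps $\mathbb{R}^2\to\mathbb{R}^2$; $\mathbb{N}$ includes $0$. $\mathcal{A}(\Omega)$ (resp. $\mathcal{A}(\Omega,\mathrm{Sym})$) is the set of scalar (resp. $\mathrm{Sym}$-valued) distributions on $\Omega$ whose singular support is contained in $\{O\}$; their restriction to $\Omega-O$ is given by a smooth function and is identified with it. Tensor distributions act by $\boldsymbol{T}(\boldsymbol{\phi})=T_{ij}(\phi_{ij})$ (summation convention). For a vector distribution, $\operatorname{Curl}\boldsymbol{v}=\partial_1v_2-\partial_2v_1$ (a scalar); for a tensor distribution, $(\operatorname{Curl}\boldsymbol{V})_i=\partial_1V_{i2}-\partial_2V_{i1}$. Thus $\operatorname{Curl}\operatorname{Curl}\boldsymbol{E}=\partial_1\partial_1E_{22}-2\partial_1\partial_2E_{12}+\partial_2\partial_2E_{11}$. $\operatorname{curl}$ denotes the same operators applied classically to smooth functions. $\mathbb{A}$ is the linear map on $2\times2$ tensors defined by $\mathbb{A}(\boldsymbol{v}\otimes\boldsymbol{w})=(\boldsymbol{e}_3\times\boldsymbol{v})\otimes(\boldsymbol{e}_3\times\boldsymbol{w})$, where $\boldsymbol{e}_3\times\boldsymbol{v}=-v_2\boldsymbol{e}_1+v_1\boldsymbol{e}_2$; $\nabla^2w$ is the Hessian of $w$. Thus $\mathbb{A}\nabla^2w$ has components $(\mathbb{A}\nabla^2w)_{11}=\partial_2\partial_2w$, $(\mathbb{A}\nabla^2w)_{22}=\partial_1\partial_1w$,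 $(\mathbb{A}\nabla^2w)_{12}=(\mathbb{A}\nabla^2w)_{21}=-\partial_1\partial_2w$. Degree of divergence (with respect to $O$): choose an open ball $B_r\subset\Omega$ centred at $O$. For a test function $\phi$ on $B_r$ and $0<\lambda<1$ put $\phi_\lambda(\boldsymbol{x})=\lambda^{-2}\phi(\boldsymbol{x}/\lambda)$ and $(T|_{B_r})_\lambda(\phi)=T(\phi_\lambda)$. The scaling degree is $\operatorname{sd}(T)=\inf\{k\in\mathbb{R}:\lim_{\lambda\to0}\lambda^k(T|_{B_r})_\lambda=0 \text{ in the sense of distributions}\}$ and $\deg(T)=\operatorname{sd}(T)-2$ (with value $-\infty$ if the infimum is over all of $\mathbb{R}$). For tensor valued distributions the same definition is used with tensor valued test functions (equivalently, the maximum over components). *)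

theory Defs
  imports "HOL-Analysis.Analysis"
begin

section \<open>Partial derivatives and smooth functions on the plane\<close>

definition pd :: "2 \<Rightarrow> (real^2 \<Rightarrow> 'b::real_normed_vector) \<Rightarrow> real^2 \<Rightarrow> 'b" where
  "pd i f x = frechet_derivative f (at x) (axis i 1)"

type_synonym multi_index = "nat \<times> nat"

definition mi_abs :: "multi_index \<Rightarrow> nat" where
  "mi_abs \<alpha> = fst \<alpha> + snd \<alpha>"

definition mpd :: "multi_index \<Rightarrow> (real^2 \<Rightarrow> 'b::real_normed_vector) \<Rightarrow> real^2 \<Rightarrow> 'b" where
  "mpd \<alpha> f = (pd 1 ^^ fst \<alpha>) ((pd 2 ^^ snd \<alpha>) f)"

text \<open>Smoothness on an open set: every iterated partial derivative, in any order, is again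
  Frechet differentiable (hence continuous) at all points of the set.\<close>

definition smooth_on :: "(real^2) set \<Rightarrow> (real^2 \<Rightarrow> 'b::real_normed_vector) \<Rightarrow> bool" where
  "smooth_on S f \<longleftrightarrow> (\<forall>is :: 2 list. \<forall>x\<in>S. foldr pd is f differentiable (at x))"

section \<open>Distributions\<close>

definition supp :: "(real^2 \<Rightarrow> 'b::real_normed_vector) \<Rightarrow> (real^2) set" where
  "supp \<phi> = closure {x. \<phi> x \<noteq> 0}"

text \<open>Elements of the test space over \<open>\<Omega>\<close> are represented by their extension by zero to the
  whole plane.\<close>

definition test_fun :: "(real^2) set \<Rightarrow> (real^2 \<Rightarrow> 'b::real_normed_vector) set" where
  "test_fun \<Omega> = {\<phi>. smooth_on UNIV \<phi> \<and> compact (supp \<phi>) \<and> supp \<phi> \<subseteq> \<Omega>}"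

type_synonym dist = "(real^2 \<Rightarrow> real) \<Rightarrow> real"

text \<open>Only the values on \<open>test_fun \<Omega>\<close> are meaningful; in particular, equality of distributions
  on \<open>\<Omega>\<close> means equality on \<open>test_fun \<Omega>\<close>. Continuity is expressed by the usual seminorm
  estimates on compact subsets.\<close>

definition distribution_on :: "(real^2) set \<Rightarrow> dist \<Rightarrow> bool" where
  "distribution_on \<Omega> T \<longleftrightarrow>
     (\<forall>\<phi>\<in>test_fun \<Omega>. \<forall>\<psi>\<in>test_fun \<Omega>. T (\<lambda>x. \<phi> x + \<psi> x) = T \<phi> + T \<psi>) \<and>
     (\<forall>c. \<forall>\<phi>\<in>test_fun \<Omega>. T (\<lambda>x. c * \<phi> x) = c * T \<phi>) \<and>
     (\<forall>K. compact K \<and> K \<subseteq> \<Omega> \<longrightarrow>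
        (\<exists>C m. \<forall>\<phi>\<in>test_fun \<Omega>. supp \<phi> \<subseteq> K \<longrightarrow>
           \<bar>T \<phi>\<bar> \<le> C * (\<Sum>\<alpha> | mi_abs \<alpha> \<le> m. SUP x. \<bar>mpd \<alpha> \<phi> x\<bar>)))"

definition given_by :: "(real^2) set \<Rightarrow> dist \<Rightarrow> (real^2 \<Rightarrow> real) \<Rightarrow> bool" where
  "given_by U T f \<longleftrightarrow> smooth_on U f \<and> (\<forall>\<phi>\<in>test_fun U. T \<phi> = (LINT x:U|lborel. f x * \<phi> x))"

definition sing_supp :: "(real^2) set \<Rightarrow> dist \<Rightarrow> (real^2) set" where
  "sing_supp \<Omega> T = {x\<in>\<Omega>. \<not> (\<exists>U f. open U \<and> x \<in> U \<and> U \<subseteq> \<Omega> \<and> given_by U T f)}"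

definition \<A> :: "(real^2) set \<Rightarrow> dist set" where
  "\<A> \<Omega> = {T. distribution_on \<Omega> T \<and> sing_supp \<Omega> T \<subseteq> {0}}"

text \<open>A tensor distribution is the matrix of its components.\<close>

definition \<A>_Sym :: "(real^2) set \<Rightarrow> (dist^2^2) set" where
  "\<A>_Sym \<Omega> = {T. (\<forall>i j. T$i$j \<in> \<A> \<Omega>) \<and> (\<forall>i j. \<forall>\<phi>\<in>test_fun \<Omega>. (T$i$j) \<phi> = (T$j$i) \<phi>)}"

definition tensor_apply :: "dist^2^2 \<Rightarrow> (real^2 \<Rightarrow> real^2^2) \<Rightarrow> real" where
  "tensor_apply T \<Phi> = (\<Sum>i\<in>UNIV. \<Sum>j\<in>UNIV. (T$i$j) (\<lambda>x. \<Phi> x $ i $ j))"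

text \<open>The smooth function representing a distribution on an open set \<open>U\<close> on which it has no
  singularities. It is determined only on \<open>U\<close>.\<close>

definition smooth_rep :: "(real^2) set \<Rightarrow> dist \<Rightarrow> real^2 \<Rightarrow> real" where
  "smooth_rep U T = (SOME f. given_by U T f)"

definition smooth_rep_tensor :: "(real^2) set \<Rightarrow> dist^2^2 \<Rightarrow> real^2 \<Rightarrow> real^2^2" where
  "smooth_rep_tensor U T x = (\<chi> i j. smooth_rep U (T$i$j) x)"

section \<open>Curl, distributional (capitalised) and classical\<close>

definition dist_pd :: "2 \<Rightarrow> dist \<Rightarrow> dist" where
  "dist_pd i T \<phi> = - T (pd i \<phi>)"

definition Curl :: "dist^2 \<Rightarrow> dist" where
  "Curl v = (\<lambda>\<phi>. dist_pd 1 (v$2) \<phi> - dist_pd 2 (v$1) \<phi>)"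

definition Curl_tensor :: "dist^2^2 \<Rightarrow> dist^2" where
  "Curl_tensor V = (\<chi> i. (\<lambda>\<phi>. dist_pd 1 (V$i$2) \<phi> - dist_pd 2 (V$i$1) \<phi>))"

definition curl :: "(real^2 \<Rightarrow> real^2) \<Rightarrow> real^2 \<Rightarrow> real" where
  "curl v x = pd 1 (\<lambda>y. v y $ 2) x - pd 2 (\<lambda>y. v y $ 1) x"

definition curl_tensor :: "(real^2 \<Rightarrow> real^2^2) \<Rightarrow> real^2 \<Rightarrow> real^2" where
  "curl_tensor V x = (\<chi> i. pd 1 (\<lambda>y. V y $ i $ 2) x - pd 2 (\<lambda>y. V y $ i $ 1) x)"

section \<open>The operator \<open>\<bbbA>\<close> and the Hessian\<close>

definition e3_cross :: "real^2 \<Rightarrow> real^2" where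
  "e3_cross v = vector [- (v$2), v$1]"

definition tensor_prod :: "real^2 \<Rightarrow> real^2 \<Rightarrow> real^2^2" where
  "tensor_prod v w = (\<chi> i j. v$i * w$j)"

text \<open>The linear map determined by \<open>v \<otimes> w \<mapsto> (e\<^sub>3 \<times> v) \<otimes> (e\<^sub>3 \<times> w)\<close>, by \<open>linear_bbA\<close> and
  \<open>bbA_tensor_prod\<close>.\<close>

definition bbA :: "real^2^2 \<Rightarrow> real^2^2" where
  "bbA M = matrix e3_cross ** M ** transpose (matrix e3_cross)"

definition hessian :: "(real^2 \<Rightarrow> real) \<Rightarrow> real^2 \<Rightarrow> real^2^2" where
  "hessian w x = (\<chi> i j. pd i (pd j w) x)"

lemma bbA_components:
  "bbA M $ 1 $ 1 = M$2$2" "bbA M $ 1 $ 2 = - (M$2$1)"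
  "bbA M $ 2 $ 1 = - (M$1$2)" "bbA M $ 2 $ 2 = M$1$1"
  by (simp_all add: bbA_def matrix_matrix_mult_def matrix_def transpose_def e3_cross_def sum_2 axis_def)

lemma linear_bbA: "linear bbA"
  by (rule linearI) (simp_all add: vec_eq_iff forall_2 bbA_components)

lemma bbA_tensor_prod: "bbA (tensor_prod v w) = tensor_prod (e3_cross v) (e3_cross w)"
  by (simp add: vec_eq_iff forall_2 bbA_components) (simp add: tensor_prod_def e3_cross_def)

section \<open>Scaling degree and degree of divergence at the origin\<close>

definition rescale :: "real \<Rightarrow> (real^2 \<Rightarrow> 'b::real_normed_vector) \<Rightarrow> real^2 \<Rightarrow> 'b" where
  "rescale l \<phi> x = (1 / l\<^sup>2) *\<^sub>R \<phi> ((1 / l) *\<^sub>R x)"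

text \<open>\<open>T\<close> is a functional on test functions with values in \<open>'b\<close>, so this covers scalar distributions
  as well as tensor distributions (through \<open>tensor_apply\<close>); \<open>r\<close> is the radius of the chosen
  ball around the origin. The infimum is taken in the extended reals.\<close>

definition scaling_degree :: "real \<Rightarrow> ((real^2 \<Rightarrow> 'b::real_normed_vector) \<Rightarrow> real) \<Rightarrow> ereal" where
  "scaling_degree r T =
     Inf (ereal ` {k. \<forall>\<phi>\<in>test_fun (ball 0 r). ((\<lambda>l. l powr k * T (rescale l \<phi>)) \<longlongrightarrow> 0) (at_right 0)})"

definition deg :: "real \<Rightarrow> ((real^2 \<Rightarrow> 'b::real_normed_vector) \<Rightarrow> real) \<Rightarrow> ereal" where
  "deg r T = scaling_degree r T - 2"

end

theory Submission
  imports Defs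
begin

text \<open>
  Let \<open>T = Curl Curl E - N\<close>. The incompatibility equation says that \<open>T\<close> vanishes on all test
  functions, and each of the three conditions removes one part of \<open>T\<close>.

  Off the origin \<open>E\<close> and \<open>N\<close> have smooth densities, glued together from local ones
  (\<open>given_by_smooth_rep\<close>). Integration by parts and the fundamental lemma of the calculus of
  variations then show that (i) means exactly that \<open>T\<close> vanishes on test functions supported away
  from the origin (\<open>classical_incompatibility_iff\<close>).

  Such a \<open>T\<close> is concentrated at the origin. Near the origin it has some finite order \<open>m\<close>, so it does
  not see a test function whose derivatives up to order \<open>m\<close> vanish there
  (\<open>eq_0_if_vanishing_at_origin\<close>). Subtracting from \<open>\<phi>\<close> the combination of the \<open>w \<alpha>\<close> that has the
  same derivatives gives \<open>T \<phi> = (\<Sum>|\<alpha>| \<le> m. (-1)^|\<alpha>| \<partial>\<^sup>\<alpha>\<phi>(0) T (w \<alpha>))\<close>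
  (\<open>expansion_at_origin\<close>). It remains to see that all the numbers \<open>T (w \<alpha>)\<close> are zero. If
  \<open>|\<alpha>| \<le> deg E + 2\<close>, this is (ii), because \<open>Curl Curl\<close> is the adjoint of \<open>\<bbbA>\<nabla>\<^sup>2\<close>.
  If \<open>|\<alpha>| > deg E + 2\<close>, it follows from scaling (\<open>eq_0_by_scaling\<close>): on a localised
  \<open>w \<alpha>\<close>, shrinking by \<open>l\<close> multiplies \<open>T\<close> by \<open>l powr - (2 + |\<alpha>|)\<close>, whereas the scaling degree of
  \<open>T\<close> is less than \<open>2 + |\<alpha>|\<close>. Indeed \<open>Curl Curl\<close> raises the scaling degree by at most \<open>2\<close>,
  and (iii) gives the same bound for \<open>N\<close>. The argument covers infinite degrees too, since it
  compares \<open>deg E + 2\<close> with one \<open>|\<alpha>|\<close> at a time.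

  Conversely, the equation restricts to (i), yields (ii) on the functions \<open>w \<alpha>\<close>, and yields (iii)
  because the two derivatives of \<open>Curl Curl\<close> cost a factor \<open>l powr -2\<close> under rescaling.
\<close>

section \<open>Calculus of iterated partial derivatives\<close>

text \<open>The recursion on the order, rather than the lists of directions in the definition of smoothness,
  is what makes the product, quotient and chain rules provable by induction: each of them expresses
  a partial derivative through functions of the same kind. The index \<open>n\<close> stands for
  \<open>n + 1\<close> times differentiable.\<close>

primrec diff_upto :: "nat \<Rightarrow> (real^2) set \<Rightarrow> (real^2 \<Rightarrow> 'b::real_normed_vector) \<Rightarrow> bool" where
  "diff_upto 0 S f \<longleftrightarrow> (\<forall>x\<in>S. f differentiable (at x))"
| "diff_upto (Suc n) S f \<longleftrightarrow> (\<forall>x\<in>S. f differentiable (at x)) \<and> (\<forall>i. diff_upto n S (pd i f))"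

lemma diff_upto_iff_lists:
  "diff_upto n S f \<longleftrightarrow> (\<forall>is. length is \<le> n \<longrightarrow> (\<forall>x\<in>S. foldr pd is f differentiable (at x)))"
proof (induction n arbitrary: f)
  case (Suc n)
  have "(\<forall>is. length is \<le> Suc n \<longrightarrow> P is) \<longleftrightarrow> P [] \<and> (\<forall>i is. length is \<le> n \<longrightarrow> P (is @ [i]))"
    for P :: "2 list \<Rightarrow> bool"
    by (metis Suc_le_mono length_append_singleton list.size(3) rev_exhaust zero_le)
  then show ?case
    by (simp only: diff_upto.simps Suc.IH foldr_append foldr.simps o_apply id_apply)
qed simp

lemma smooth_on_iff_diff_upto: "smooth_on S f \<longleftrightarrow> (\<forall>n. diff_upto n S f)"
  unfolding smooth_on_def diff_upto_iff_lists by blast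

lemma diff_upto_differentiable: "diff_upto n S f \<Longrightarrow> x \<in> S \<Longrightarrow> f differentiable (at x)"
  by (cases n) auto

lemma diff_upto_decrease: "diff_upto (Suc n) S f \<Longrightarrow> diff_upto n S f"
  unfolding diff_upto_iff_lists by (meson le_SucI)

lemma smooth_on_pd: "smooth_on S f \<Longrightarrow> smooth_on S (pd i f)"
  unfolding smooth_on_iff_diff_upto by (metis diff_upto.simps(2))

lemma smooth_on_differentiable: "smooth_on S f \<Longrightarrow> x \<in> S \<Longrightarrow> f differentiable (at x)"
  unfolding smooth_on_iff_diff_upto using diff_upto_differentiable by blast

lemma smooth_on_foldr_pd: "smooth_on S f \<Longrightarrow> smooth_on S (foldr pd is f)"
  by (induction "is") (auto intro: smooth_on_pd)

lemma smooth_on_continuous: "smooth_on S f \<Longrightarrow> x \<in> S \<Longrightarrow> continuous (at x) f"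
  by (simp add: differentiable_imp_continuous_within smooth_on_differentiable)

lemma smooth_on_continuous_on: "smooth_on S f \<Longrightarrow> continuous_on S f"
  by (simp add: continuous_at_imp_continuous_on smooth_on_continuous)

lemma smooth_on_subset: "smooth_on S f \<Longrightarrow> T \<subseteq> S \<Longrightarrow> smooth_on T f"
  unfolding smooth_on_def by blast

lemma smooth_on_Un: "smooth_on S f \<Longrightarrow> smooth_on T f \<Longrightarrow> smooth_on (S \<union> T) f"
  unfolding smooth_on_def by blast

lemma pd_eqI: "(f has_derivative D) (at x) \<Longrightarrow> pd i f x = D (axis i 1)"
  by (simp add: frechet_derivative_at[symmetric] pd_def)

lemma has_derivative_frechet:
  "f differentiable (at x) \<Longrightarrow> (f has_derivative frechet_derivative f (at x)) (at x)"
  by (simp add: frechet_derivative_works)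

lemma pd_cong_open:
  assumes "open S" "\<And>x. x \<in> S \<Longrightarrow> f x = g x" "x \<in> S"
  shows "pd i f x = pd i g x"
proof -
  have "(f has_derivative D) (at x) \<longleftrightarrow> (g has_derivative D) (at x)" for D
    using has_derivative_transform_within_open[of f D x UNIV S g]
      has_derivative_transform_within_open[of g D x UNIV S f] assms by auto
  then show ?thesis
    by (simp add: pd_def frechet_derivative_def)
qed

lemma foldr_pd_cong_open:
  assumes "open S" "\<And>x. x \<in> S \<Longrightarrow> f x = g x" "x \<in> S"
  shows "foldr pd is f x = foldr pd is g x"
  using assms(3) by (induction "is" arbitrary: x) (use assms in \<open>auto intro: pd_cong_open\<close>)

lemma differentiable_cong_open:
  assumes "open S" "\<And>x. x \<in> S \<Longrightarrow> f x = g x" "x \<in> S" "f differentiable (at x)"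
  shows "g differentiable (at x)"
  using assms by (meson differentiable_def has_derivative_transform_within_open)

lemma diff_upto_cong_open:
  assumes "open S" "\<And>x. x \<in> S \<Longrightarrow> f x = g x" "diff_upto n S f"
  shows "diff_upto n S g"
  unfolding diff_upto_iff_lists
proof (intro allI impI ballI)
  fix "is" :: "2 list" and x assume "length is \<le> n" "x \<in> S"
  then have "foldr pd is f differentiable (at x)"
    using assms(3) diff_upto_iff_lists by blast
  then show "foldr pd is g differentiable (at x)"
    by (rule differentiable_cong_open[rotated 3])
      (use assms \<open>x \<in> S\<close> in \<open>auto intro: foldr_pd_cong_open\<close>)
qed

lemma smooth_on_cong_open:
  "open S \<Longrightarrow> (\<And>x. x \<in> S \<Longrightarrow> f x = g x) \<Longrightarrow> smooth_on S f \<Longrightarrow> smooth_on S g"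
  unfolding smooth_on_iff_diff_upto using diff_upto_cong_open by blast

lemma pd_const [simp]: "pd i (\<lambda>x. c) = (\<lambda>x. 0)"
  by (simp add: pd_def fun_eq_iff)

lemma diff_upto_const [simp]: "diff_upto n S (\<lambda>x. c)"
  by (induction n arbitrary: c) auto

lemma smooth_on_const [simp]: "smooth_on S (\<lambda>x. c)"
  by (simp add: smooth_on_iff_diff_upto)

lemma pd_add:
  "f differentiable (at x) \<Longrightarrow> g differentiable (at x) \<Longrightarrow>
    pd i (\<lambda>x. f x + g x) x = pd i f x + pd i g x"
  using pd_eqI[OF has_derivative_add[OF has_derivative_frechet has_derivative_frechet], of f x g i]
  by (simp add: pd_def)

lemma pd_mult:
  fixes f g :: "real^2 \<Rightarrow> real"
  shows "f differentiable (at x) \<Longrightarrow> g differentiable (at x) \<Longrightarrow>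
    pd i (\<lambda>x. f x * g x) x = f x * pd i g x + pd i f x * g x"
  using pd_eqI[OF has_derivative_mult[OF has_derivative_frechet has_derivative_frechet], of f x g i]
  by (simp add: pd_def)

lemma pd_bounded_linear:
  assumes "bounded_linear L" "f differentiable (at x)"
  shows "pd i (\<lambda>x. L (f x)) x = L (pd i f x)"
  using pd_eqI[OF bounded_linear.has_derivative[OF assms(1) has_derivative_frechet[OF assms(2)]]]
  by (simp add: pd_def)

lemma pd_inverse:
  fixes f :: "real^2 \<Rightarrow> real"
  assumes "f differentiable (at x)" "f x \<noteq> 0"
  shows "pd i (\<lambda>x. inverse (f x)) x = - (inverse (f x) * pd i f x * inverse (f x))"
  using pd_eqI[OF Deriv.has_derivative_inverse[OF assms(2) has_derivative_frechet[OF assms(1)]]]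
  by (simp add: pd_def)

lemma diff_upto_add:
  assumes "open S"
  shows "diff_upto n S f \<Longrightarrow> diff_upto n S g \<Longrightarrow> diff_upto n S (\<lambda>x. f x + g x)"
proof (induction n arbitrary: f g)
  case (Suc n)
  show ?case
    unfolding diff_upto.simps
  proof (intro conjI ballI allI)
    fix x assume "x \<in> S" then show "(\<lambda>x. f x + g x) differentiable (at x)"
      using Suc.prems by simp
  next
    fix i
    have "diff_upto n S (\<lambda>x. pd i f x + pd i g x)"
      using Suc by simp
    then show "diff_upto n S (pd i (\<lambda>x. f x + g x))"
      by (rule diff_upto_cong_open[OF assms, rotated]) (use Suc.prems in \<open>simp add: pd_add\<close>)
  qed
qed auto

lemma diff_upto_mult:
  fixes f g :: "real^2 \<Rightarrow> real"
  assumes "open S"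
  shows "diff_upto n S f \<Longrightarrow> diff_upto n S g \<Longrightarrow> diff_upto n S (\<lambda>x. f x * g x)"
proof (induction n arbitrary: f g)
  case (Suc n)
  show ?case
    unfolding diff_upto.simps
  proof (intro conjI ballI allI)
    fix x assume "x \<in> S" then show "(\<lambda>x. f x * g x) differentiable (at x)"
      using Suc.prems by simp
  next
    fix i
    have "diff_upto n S (\<lambda>x. f x * pd i g x + pd i f x * g x)"
      using Suc.prems diff_upto_decrease[OF Suc.prems(1)] diff_upto_decrease[OF Suc.prems(2)]
      by (intro diff_upto_add assms Suc.IH) auto
    then show "diff_upto n S (pd i (\<lambda>x. f x * g x))"
      by (rule diff_upto_cong_open[OF assms, rotated]) (use Suc.prems in \<open>simp add: pd_mult\<close>)
  qed
qed auto

lemma differentiable_bounded_linear: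
  "bounded_linear L \<Longrightarrow> f differentiable F \<Longrightarrow> (\<lambda>x. L (f x)) differentiable F"
  unfolding differentiable_def using bounded_linear.has_derivative by blast

lemma diff_upto_bounded_linear:
  assumes "open S" "bounded_linear L"
  shows "diff_upto n S f \<Longrightarrow> diff_upto n S (\<lambda>x. L (f x))"
proof (induction n arbitrary: f)
  case 0
  then show ?case
    using assms(2) by (simp add: differentiable_bounded_linear)
next
  case (Suc n)
  show ?case
    unfolding diff_upto.simps
  proof (intro conjI ballI allI)
    fix x assume "x \<in> S" then show "(\<lambda>x. L (f x)) differentiable (at x)"
      using Suc.prems assms(2) by (simp add: differentiable_bounded_linear)
  next
    fix i
    have "diff_upto n S (\<lambda>x. L (pd i f x))"
      using Suc by simp
    then show "diff_upto n S (pd i (\<lambda>x. L (f x)))"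
      by (rule diff_upto_cong_open[OF assms(1), rotated])
        (use Suc.prems assms(2) in \<open>simp add: pd_bounded_linear\<close>)
  qed
qed

lemma diff_upto_inverse:
  fixes f :: "real^2 \<Rightarrow> real"
  assumes "open S" "\<And>x. x \<in> S \<Longrightarrow> f x \<noteq> 0"
  shows "diff_upto n S f \<Longrightarrow> diff_upto n S (\<lambda>x. inverse (f x))"
proof (induction n)
  case 0
  then show ?case using assms by simp
next
  case (Suc n)
  show ?case
    unfolding diff_upto.simps
  proof (intro conjI ballI allI)
    fix x assume "x \<in> S" then show "(\<lambda>x. inverse (f x)) differentiable (at x)"
      using Suc.prems assms(2) by simp
  next
    fix i
    have "diff_upto n S (\<lambda>x. inverse (f x))"
      using Suc.IH diff_upto_decrease[OF Suc.prems] by blast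
    moreover have "diff_upto n S (pd i f)"
      using Suc.prems by simp
    ultimately have "diff_upto n S (\<lambda>x. - (inverse (f x) * pd i f x * inverse (f x)))"
      by (intro diff_upto_bounded_linear[OF assms(1) bounded_linear_minus[OF bounded_linear_ident]]
          diff_upto_mult assms)
    then show "diff_upto n S (pd i (\<lambda>x. inverse (f x)))"
      by (rule diff_upto_cong_open[OF assms(1), rotated])
        (use Suc.prems assms(2) in \<open>simp add: pd_inverse\<close>)
  qed
qed

lemma smooth_on_add:
  "open S \<Longrightarrow> smooth_on S f \<Longrightarrow> smooth_on S g \<Longrightarrow> smooth_on S (\<lambda>x. f x + g x)"
  by (simp add: smooth_on_iff_diff_upto diff_upto_add)

lemma smooth_on_mult:
  fixes f g :: "real^2 \<Rightarrow> real"
  shows "open S \<Longrightarrow> smooth_on S f \<Longrightarrow> smooth_on S g \<Longrightarrow> smooth_on S (\<lambda>x. f x * g x)"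
  by (simp add: smooth_on_iff_diff_upto diff_upto_mult)

lemma smooth_on_bounded_linear:
  "open S \<Longrightarrow> bounded_linear L \<Longrightarrow> smooth_on S f \<Longrightarrow> smooth_on S (\<lambda>x. L (f x))"
  by (simp add: smooth_on_iff_diff_upto diff_upto_bounded_linear)

lemma smooth_on_inverse:
  fixes f :: "real^2 \<Rightarrow> real"
  shows "open S \<Longrightarrow> (\<And>x. x \<in> S \<Longrightarrow> f x \<noteq> 0) \<Longrightarrow> smooth_on S f \<Longrightarrow> smooth_on S (\<lambda>x. inverse (f x))"
  by (simp add: smooth_on_iff_diff_upto diff_upto_inverse)

lemma smooth_on_cmult:
  fixes f :: "real^2 \<Rightarrow> real"
  shows "open S \<Longrightarrow> smooth_on S f \<Longrightarrow> smooth_on S (\<lambda>x. c * f x)"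
  by (simp add: smooth_on_mult)

lemma smooth_on_diff:
  fixes f :: "real^2 \<Rightarrow> real"
  shows "open S \<Longrightarrow> smooth_on S f \<Longrightarrow> smooth_on S g \<Longrightarrow> smooth_on S (\<lambda>x. f x - g x)"
  using smooth_on_add[of S f "\<lambda>x. (-1) * g x"] smooth_on_cmult[of S g "-1"] by simp

lemma smooth_on_sum:
  "open S \<Longrightarrow> (\<And>a. a \<in> A \<Longrightarrow> smooth_on S (f a)) \<Longrightarrow> smooth_on S (\<lambda>x. \<Sum>a\<in>A. f a x)"
  by (induction A rule: infinite_finite_induct) (auto intro: smooth_on_add)

lemma smooth_pd_add:
  "smooth_on UNIV f \<Longrightarrow> smooth_on UNIV g \<Longrightarrow> pd i (\<lambda>x. f x + g x) = (\<lambda>x. pd i f x + pd i g x)"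
  by (rule ext, rule pd_add) (auto intro: smooth_on_differentiable)

lemma smooth_pd_cmult:
  fixes f :: "real^2 \<Rightarrow> real"
  shows "smooth_on UNIV f \<Longrightarrow> pd i (\<lambda>x. c * f x) = (\<lambda>x. c * pd i f x)"
  by (rule ext, rule pd_bounded_linear[OF bounded_linear_mult_right]) (auto intro: smooth_on_differentiable)

lemma smooth_pd_mult:
  fixes f g :: "real^2 \<Rightarrow> real"
  shows "smooth_on UNIV f \<Longrightarrow> smooth_on UNIV g \<Longrightarrow>
    pd i (\<lambda>x. f x * g x) = (\<lambda>x. f x * pd i g x + pd i f x * g x)"
  by (rule ext, rule pd_mult) (auto intro: smooth_on_differentiable)

lemma pd_scaled_argument:
  assumes "\<And>x. f differentiable (at x)"
  shows "pd i (\<lambda>x. f (c *\<^sub>R x)) x = c *\<^sub>R pd i f (c *\<^sub>R x)"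
proof -
  have "((\<lambda>x. c *\<^sub>R x) has_derivative (\<lambda>h. c *\<^sub>R h)) (at x)"
    by (auto intro!: derivative_eq_intros)
  from has_derivative_compose[OF this has_derivative_frechet[OF assms]]
  have "pd i (\<lambda>x. f (c *\<^sub>R x)) x = frechet_derivative f (at (c *\<^sub>R x)) (c *\<^sub>R axis i 1)"
    by (rule pd_eqI)
  also have "\<dots> = c *\<^sub>R pd i f (c *\<^sub>R x)"
    using linear_frechet_derivative[OF assms, of "c *\<^sub>R x"] by (simp add: pd_def linear_cmul)
  finally show ?thesis .
qed

lemma diff_upto_scaled_argument:
  "diff_upto n UNIV f \<Longrightarrow> diff_upto n UNIV (\<lambda>x. f (c *\<^sub>R x))"
proof (induction n arbitrary: f)
  case 0
  then show ?case
    using differentiable_compose[of f "\<lambda>x. c *\<^sub>R x"] by simp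
next
  case (Suc n)
  then have d: "f differentiable (at x)" for x by simp
  have "diff_upto n UNIV (\<lambda>x. c *\<^sub>R pd i f (c *\<^sub>R x))" for i
    using Suc by (intro diff_upto_bounded_linear[OF open_UNIV bounded_linear_scaleR_right]) simp
  then show ?case
    using differentiable_compose[of f "\<lambda>x. c *\<^sub>R x"] d
    by (simp add: pd_scaled_argument[OF d, abs_def])
qed

lemma smooth_on_scaled_argument: "smooth_on UNIV f \<Longrightarrow> smooth_on UNIV (\<lambda>x. f (c *\<^sub>R x))"
  by (simp add: smooth_on_iff_diff_upto diff_upto_scaled_argument)

section \<open>Symmetry of second derivatives\<close>

lemma has_real_derivative_along_axis:
  fixes f :: "real^2 \<Rightarrow> real"
  assumes "\<And>x. f differentiable (at x)"
  shows "((\<lambda>s. f (x + s *\<^sub>R axis i 1)) has_real_derivative pd i f (x + s *\<^sub>R axis i 1)) (at s)"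
proof -
  let ?y = "x + s *\<^sub>R axis i 1"
  have "((\<lambda>s. x + s *\<^sub>R axis i 1) has_derivative (\<lambda>h. h *\<^sub>R axis i 1)) (at s)"
    by (auto intro!: derivative_eq_intros)
  from has_derivative_compose[OF this has_derivative_frechet[OF assms]]
  have "((\<lambda>s. f (x + s *\<^sub>R axis i 1)) has_derivative
      (\<lambda>h. frechet_derivative f (at ?y) (h *\<^sub>R axis i 1))) (at s)" .
  moreover have "(\<lambda>h. frechet_derivative f (at ?y) (h *\<^sub>R axis i 1)) = (*) (pd i f ?y)"
    using linear_frechet_derivative[OF assms, of ?y] by (auto simp: pd_def linear_cmul)
  ultimately show ?thesis
    by (simp add: has_field_derivative_def)
qed

text \<open>Two applications of the mean value theorem. The left-hand side is symmetric in \<open>i\<close> and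
  \<open>j\<close>, so exchanging them produces a mixed derivative in the other order near the same
  point.\<close>

lemma second_difference:
  fixes f :: "real^2 \<Rightarrow> real"
  assumes "smooth_on UNIV f" "h > 0"
  obtains s t where "0 < s" "s < h" "0 < t" "t < h"
    "f (x + h *\<^sub>R axis i 1 + h *\<^sub>R axis j 1) - f (x + h *\<^sub>R axis i 1) - f (x + h *\<^sub>R axis j 1) + f x
      = h\<^sup>2 * pd j (pd i f) (x + s *\<^sub>R axis i 1 + t *\<^sub>R axis j 1)"
proof -
  have d: "f differentiable (at x)" "pd i f differentiable (at x)" for x
    using assms smooth_on_pd smooth_on_differentiable by blast+
  define u where "u s = f (x + h *\<^sub>R axis j 1 + s *\<^sub>R axis i 1) - f (x + s *\<^sub>R axis i 1)" for s
  have u': "(u has_real_derivative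
      pd i f (x + h *\<^sub>R axis j 1 + s *\<^sub>R axis i 1) - pd i f (x + s *\<^sub>R axis i 1)) (at s)" for s
    unfolding u_def by (intro DERIV_diff has_real_derivative_along_axis d)
  obtain s where s: "0 < s" "s < h"
    "u h - u 0 = (h - 0) * (pd i f (x + h *\<^sub>R axis j 1 + s *\<^sub>R axis i 1) - pd i f (x + s *\<^sub>R axis i 1))"
    using MVT2[OF \<open>h > 0\<close> u'] by blast
  obtain t where t: "0 < t" "t < h"
    "pd i f (x + s *\<^sub>R axis i 1 + h *\<^sub>R axis j 1) - pd i f (x + s *\<^sub>R axis i 1 + 0 *\<^sub>R axis j 1)
      = (h - 0) * pd j (pd i f) (x + s *\<^sub>R axis i 1 + t *\<^sub>R axis j 1)"
    using MVT2[OF \<open>h > 0\<close> has_real_derivative_along_axis[OF d(2), of "x + s *\<^sub>R axis i 1" j]] by blast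
  have "f (x + h *\<^sub>R axis i 1 + h *\<^sub>R axis j 1) - f (x + h *\<^sub>R axis i 1) - f (x + h *\<^sub>R axis j 1) + f x
      = u h - u 0"
    by (simp add: u_def algebra_simps)
  also have "\<dots> = h\<^sup>2 * pd j (pd i f) (x + s *\<^sub>R axis i 1 + t *\<^sub>R axis j 1)"
    using s(3) t(3) by (simp add: power2_eq_square add_ac)
  finally show ?thesis
    using that s(1,2) t(1,2) by blast
qed

text \<open>Both mixed derivatives at points within \<open>2 h\<close> of \<open>x\<close> equal the same second difference
  quotient; by continuity their values at \<open>x\<close> differ by less than any \<open>e\<close>.\<close>

lemma pd_commute:
  fixes f :: "real^2 \<Rightarrow> real"
  assumes "smooth_on UNIV f"
  shows "pd i (pd j f) = pd j (pd i f)"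
proof
  fix x
  have "\<bar>pd i (pd j f) x - pd j (pd i f) x\<bar> \<le> e" if "e > 0" for e
  proof -
    have lim: "\<exists>d>0. \<forall>y. dist y x < d \<longrightarrow> \<bar>pd k (pd l f) y - pd k (pd l f) x\<bar> < e/2" for k l
      using smooth_on_continuous[OF smooth_on_pd[OF smooth_on_pd[OF assms]], of x k l] \<open>e > 0\<close>
      unfolding continuous_at_eps_delta dist_real_def by (meson half_gt_zero UNIV_I)
    obtain d1 d2 where d: "d1 > 0" "d2 > 0"
      "\<And>y. dist y x < d1 \<Longrightarrow> \<bar>pd i (pd j f) y - pd i (pd j f) x\<bar> < e/2"
      "\<And>y. dist y x < d2 \<Longrightarrow> \<bar>pd j (pd i f) y - pd j (pd i f) x\<bar> < e/2"
      using lim by meson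
    define h where "h = min d1 d2 / 2"
    have h: "h > 0" "2 * h \<le> d1" "2 * h \<le> d2"
      using d by (auto simp: h_def)
    have near: "dist (x + s *\<^sub>R axis k 1 + t *\<^sub>R axis l 1) x < 2 * h"
      if "0 < s" "s < h" "0 < t" "t < h" for s t :: real and k l
      using norm_triangle_ineq[of "s *\<^sub>R axis k 1" "t *\<^sub>R axis l 1 :: real^2"] that
      by (simp add: dist_norm add.assoc norm_axis_1)
    obtain s t where st: "0 < s" "s < h" "0 < t" "t < h"
      "f (x + h *\<^sub>R axis i 1 + h *\<^sub>R axis j 1) - f (x + h *\<^sub>R axis i 1) - f (x + h *\<^sub>R axis j 1) + f x
      = h\<^sup>2 * pd j (pd i f) (x + s *\<^sub>R axis i 1 + t *\<^sub>R axis j 1)"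
      using second_difference[OF assms h(1)] by metis
    obtain s' t' where st': "0 < s'" "s' < h" "0 < t'" "t' < h"
      "f (x + h *\<^sub>R axis j 1 + h *\<^sub>R axis i 1) - f (x + h *\<^sub>R axis j 1) - f (x + h *\<^sub>R axis i 1) + f x
      = h\<^sup>2 * pd i (pd j f) (x + s' *\<^sub>R axis j 1 + t' *\<^sub>R axis i 1)"
      using second_difference[OF assms h(1)] by metis
    have "h\<^sup>2 * pd j (pd i f) (x + s *\<^sub>R axis i 1 + t *\<^sub>R axis j 1)
        = h\<^sup>2 * pd i (pd j f) (x + s' *\<^sub>R axis j 1 + t' *\<^sub>R axis i 1)"
      unfolding st(5)[symmetric] st'(5)[symmetric] by (simp add: add_ac)
    then have "pd j (pd i f) (x + s *\<^sub>R axis i 1 + t *\<^sub>R axis j 1)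
        = pd i (pd j f) (x + s' *\<^sub>R axis j 1 + t' *\<^sub>R axis i 1)"
      using h(1) by simp
    then show ?thesis
      using d(3)[of "x + s' *\<^sub>R axis j 1 + t' *\<^sub>R axis i 1"] near[OF st'(1-4), of j i] h
        d(4)[of "x + s *\<^sub>R axis i 1 + t *\<^sub>R axis j 1"] near[OF st(1-4), of i j] by linarith
  qed
  then have "\<bar>pd i (pd j f) x - pd j (pd i f) x\<bar> \<le> 0"
    by (rule field_le_epsilon) simp
  then show "pd i (pd j f) x = pd j (pd i f) x" by simp
qed

lemma mpd_eq_foldr: "mpd \<alpha> f = foldr pd (replicate (fst \<alpha>) 1 @ replicate (snd \<alpha>) 2) f"
  by (simp add: mpd_def foldr_replicate)

text \<open>Bounds and vanishing conditions are stated with multi-indices, whereas inductions on the order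
  produce derivatives in arbitrary directions; symmetry lets one pass between the two.\<close>

lemma foldr_pd_eq_mpd:
  fixes f :: "real^2 \<Rightarrow> real"
  assumes "smooth_on UNIV f"
  shows "foldr pd is f = mpd (count_list is 1, count_list is 2) f"
proof (induction "is")
  case (Cons i "is")
  have pull: "pd 2 ((pd 1 ^^ n) g) = (pd 1 ^^ n) (pd 2 g)" if "smooth_on UNIV g" for n and g :: "real^2 \<Rightarrow> real"
  proof (induction n)
    case (Suc n)
    have "smooth_on UNIV ((pd 1 ^^ n) g)"
      using smooth_on_foldr_pd[OF that, of "replicate n 1"] by (simp add: foldr_replicate)
    then show ?case
      using Suc pd_commute[of "(pd 1 ^^ n) g" 2 1] by simp
  qed simp
  have "smooth_on UNIV ((pd 2 ^^ n) f)" for n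
    using smooth_on_foldr_pd[OF assms, of "replicate n 2"] by (simp add: foldr_replicate)
  note p = pull[OF this]
  show ?case
    using exhaust_2[of i] Cons by (auto simp: mpd_def p)
qed (simp add: mpd_def)

lemma length_eq_count_2: "length (is :: 2 list) = count_list is 1 + count_list is 2"
  using exhaust_2 by (induction "is") auto

section \<open>Test functions\<close>

lemma zero_outside_supp: "x \<notin> supp \<phi> \<Longrightarrow> \<phi> x = 0"
  using closure_subset[of "{x. \<phi> x \<noteq> 0}"] by (auto simp: supp_def)

lemma supp_subset_closed: "closed K \<Longrightarrow> (\<And>x. x \<notin> K \<Longrightarrow> \<phi> x = 0) \<Longrightarrow> supp \<phi> \<subseteq> K"
  unfolding supp_def by (rule closure_minimal) auto

lemma closed_supp: "closed (supp \<phi>)"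
  by (simp add: supp_def)

lemma test_funI:
  assumes "smooth_on UNIV \<phi>" "compact K" "K \<subseteq> U" "\<And>x. x \<notin> K \<Longrightarrow> \<phi> x = 0"
  shows "\<phi> \<in> test_fun U"
proof -
  have "supp \<phi> \<subseteq> K"
    by (rule supp_subset_closed) (use assms in \<open>auto intro: compact_imp_closed\<close>)
  then show ?thesis
    using assms closed_supp compact_Int_closed[of K "supp \<phi>"]
    by (auto simp: test_fun_def Int_absorb1)
qed

lemma test_funD:
  assumes "\<phi> \<in> test_fun U"
  shows "smooth_on UNIV \<phi>" "compact (supp \<phi>)" "supp \<phi> \<subseteq> U"
  using assms by (auto simp: test_fun_def)

lemma test_fun_zero_outside: "\<phi> \<in> test_fun U \<Longrightarrow> x \<notin> U \<Longrightarrow> \<phi> x = 0"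
  using zero_outside_supp test_funD(3) by blast

lemma test_fun_mono: "\<phi> \<in> test_fun U \<Longrightarrow> U \<subseteq> V \<Longrightarrow> \<phi> \<in> test_fun V"
  by (auto simp: test_fun_def)

lemma test_fun_zero [simp]: "(\<lambda>x. 0) \<in> test_fun U"
  by (rule test_funI[of _ "{}"]) auto

lemma test_fun_add:
  assumes "\<phi> \<in> test_fun U" "\<psi> \<in> test_fun U"
  shows "(\<lambda>x. \<phi> x + \<psi> x) \<in> test_fun U"
  by (rule test_funI[of _ "supp \<phi> \<union> supp \<psi>"])
    (use assms[THEN test_funD(1)] assms[THEN test_funD(2)] assms[THEN test_funD(3)] in
      \<open>auto intro: smooth_on_add simp: zero_outside_supp\<close>)

lemma test_fun_bounded_linear:
  assumes "bounded_linear L" "\<phi> \<in> test_fun U"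
  shows "(\<lambda>x. L (\<phi> x)) \<in> test_fun U"
  by (rule test_funI[of _ "supp \<phi>"])
    (use assms(1) test_funD[OF assms(2)] in
      \<open>auto intro: smooth_on_bounded_linear simp: zero_outside_supp linear_simps(3)\<close>)

lemma test_fun_cmult:
  fixes \<phi> :: "real^2 \<Rightarrow> real"
  shows "\<phi> \<in> test_fun U \<Longrightarrow> (\<lambda>x. c * \<phi> x) \<in> test_fun U"
  by (rule test_fun_bounded_linear[OF bounded_linear_mult_right])

lemma test_fun_diff:
  fixes \<phi> :: "real^2 \<Rightarrow> real"
  assumes "\<phi> \<in> test_fun U" "\<psi> \<in> test_fun U"
  shows "(\<lambda>x. \<phi> x - \<psi> x) \<in> test_fun U"
  using test_fun_add[OF assms(1) test_fun_cmult[OF assms(2), of "-1"]] by simp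

lemma test_fun_sum:
  "(\<And>a. a \<in> A \<Longrightarrow> \<phi> a \<in> test_fun U) \<Longrightarrow> (\<lambda>x. \<Sum>a\<in>A. \<phi> a x) \<in> test_fun U"
  by (induction A rule: infinite_finite_induct) (auto intro: test_fun_add)

lemma pd_zero_outside_supp:
  assumes "x \<notin> supp \<phi>"
  shows "pd i \<phi> x = 0"
proof -
  have "pd i \<phi> x = pd i (\<lambda>x. 0) x"
    by (rule pd_cong_open[of "- supp \<phi>"]) (use assms closed_supp in \<open>auto simp: zero_outside_supp\<close>)
  then show ?thesis by simp
qed

lemma test_fun_pd: "\<phi> \<in> test_fun U \<Longrightarrow> pd i \<phi> \<in> test_fun U"
  by (rule test_funI[of _ "supp \<phi>"])
    (auto simp: pd_zero_outside_supp dest: test_funD intro: smooth_on_pd)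

text \<open>The factor \<open>f\<close> may be arbitrary outside \<open>U\<close>: there, and near every point off the
  support of \<open>\<phi>\<close>, the product is zero. The open sets \<open>U\<close> and \<open>- supp \<phi>\<close> cover the
  plane.\<close>

lemma test_fun_smooth_mult:
  fixes f \<phi> :: "real^2 \<Rightarrow> real"
  assumes "open U" "smooth_on U f" "\<phi> \<in> test_fun V" "supp \<phi> \<subseteq> U"
  shows "(\<lambda>x. f x * \<phi> x) \<in> test_fun V"
proof (rule test_funI[of _ "supp \<phi>"])
  have "smooth_on U (\<lambda>x. f x * \<phi> x)"
    using assms test_funD(1) by (intro smooth_on_mult) (auto intro: smooth_on_subset)
  moreover have "smooth_on (- supp \<phi>) (\<lambda>x. f x * \<phi> x)"
    by (rule smooth_on_cong_open[of _ "\<lambda>x. 0"]) (use closed_supp in \<open>auto simp: zero_outside_supp\<close>)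
  ultimately have "smooth_on (U \<union> - supp \<phi>) (\<lambda>x. f x * \<phi> x)"
    by (rule smooth_on_Un)
  moreover have "U \<union> - supp \<phi> = UNIV"
    using assms(4) by blast
  ultimately show "smooth_on UNIV (\<lambda>x. f x * \<phi> x)" by simp
qed (use test_funD[OF assms(3)] in \<open>auto simp: zero_outside_supp\<close>)

lemma supp_pd_subset: "supp (pd i \<phi>) \<subseteq> supp \<phi>"
  by (rule supp_subset_closed[OF closed_supp]) (rule pd_zero_outside_supp)

lemma supp_foldr_pd_subset: "supp (foldr pd is \<phi>) \<subseteq> supp \<phi>"
  by (induction "is") (use supp_pd_subset in \<open>auto intro: subset_trans\<close>)

section \<open>Smooth cutoff functions\<close>

text \<open>Extended by \<open>0\<close> to nonpositive \<open>t\<close>, the functions \<open>p (1 / t) exp (- 1 / t)\<close> with \<open>p\<close> a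
  polynomial form a family closed under differentiation, which gives smoothness of all of them at
  once.\<close>

definition flat :: "real poly \<Rightarrow> real \<Rightarrow> real" where
  "flat p t = (if t > 0 then poly p (1 / t) * exp (- (1 / t)) else 0)"

lemma poly_div_exp_tendsto_0: "((\<lambda>s. poly p s / exp s) \<longlongrightarrow> (0::real)) at_top"
proof -
  have "((\<lambda>s. \<Sum>i\<le>degree p. coeff p i * (s ^ i / exp s)) \<longlongrightarrow> (\<Sum>i\<le>degree p. coeff p i * 0)) at_top"
    by (intro tendsto_sum tendsto_mult tendsto_const tendsto_power_div_exp_0)
  then show ?thesis
    by (simp add: poly_altdef sum_divide_distrib)
qed

lemma flat_has_derivative:
  "(flat p has_real_derivative flat ([:0, 0, 1:] * (p - pderiv p)) t) (at t)"
proof (cases t "0::real" rule: linorder_cases)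
  case less
  then have "((\<lambda>_. 0) has_real_derivative flat ([:0, 0, 1:] * (p - pderiv p)) t) (at t)"
    by (auto simp: flat_def)
  then show ?thesis
    by (rule has_field_derivative_transform_within_open[of _ _ _ "{..<0}"])
      (use less in \<open>auto simp: flat_def\<close>)
next
  case greater
  then have "((\<lambda>t. poly p (1 / t) * exp (- (1 / t))) has_real_derivative
      flat ([:0, 0, 1:] * (p - pderiv p)) t) (at t)"
    by (auto intro!: derivative_eq_intros DERIV_chain'[OF _ poly_DERIV, of "\<lambda>t. 1 / t"]
        simp: flat_def field_simps power2_eq_square)
  then show ?thesis
    by (rule has_field_derivative_transform_within_open[of _ _ _ "{0<..}"])
      (use greater in \<open>auto simp: flat_def\<close>)
next
  case equal
  have "((\<lambda>h. poly (pCons 0 p) (1 / h) / exp (1 / h)) \<longlongrightarrow> 0) (at_right 0)"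
    using filterlim_compose[OF poly_div_exp_tendsto_0[of "pCons 0 p"] filterlim_inverse_at_top_right]
    by (simp only: inverse_eq_divide)
  then have right: "((\<lambda>h. flat p h / h) \<longlongrightarrow> 0) (at_right 0)"
    by (rule Lim_transform_eventually)
      (auto simp: eventually_at_filter flat_def exp_minus field_simps)
  have left: "((\<lambda>h. flat p h / h) \<longlongrightarrow> 0) (at_left 0)"
    by (rule Lim_transform_eventually[OF tendsto_const])
      (auto simp: eventually_at_filter flat_def)
  from left right have "((\<lambda>h. flat p h / h) \<longlongrightarrow> 0) (at 0)"
    by (rule filterlim_split_at)
  then show ?thesis
    using equal by (simp add: DERIV_def flat_def)
qed

lemma flat_compose_has_derivative:
  assumes "f differentiable (at x)"
  shows "((\<lambda>x. flat p (f x)) has_derivative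
    (\<lambda>h. flat ([:0, 0, 1:] * (p - pderiv p)) (f x) * frechet_derivative f (at x) h)) (at x)"
  using has_derivative_compose[OF has_derivative_frechet[OF assms]
      flat_has_derivative[of p "f x", unfolded has_field_derivative_def]] .

lemma diff_upto_flat:
  assumes "open S"
  shows "diff_upto n S f \<Longrightarrow> diff_upto n S (\<lambda>x. flat p (f x))"
proof (induction n arbitrary: p)
  case 0
  then show ?case
    by (auto intro: differentiableI[OF flat_compose_has_derivative])
next
  case (Suc n)
  show ?case
    unfolding diff_upto.simps
  proof (intro conjI ballI allI)
    fix x assume "x \<in> S" then show "(\<lambda>x. flat p (f x)) differentiable (at x)"
      using diff_upto_differentiable[OF Suc.prems] by (auto intro: differentiableI[OF flat_compose_has_derivative])
  next
    fix i
    have "diff_upto n S (\<lambda>x. flat ([:0, 0, 1:] * (p - pderiv p)) (f x) * pd i f x)"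
      using Suc.prems by (intro diff_upto_mult assms Suc.IH diff_upto_decrease[OF Suc.prems]) simp
    then show "diff_upto n S (pd i (\<lambda>x. flat p (f x)))"
    proof (rule diff_upto_cong_open[OF assms, rotated])
      fix x assume "x \<in> S"
      then have "f differentiable (at x)"
        using Suc.prems by simp
      from pd_eqI[OF flat_compose_has_derivative[OF this], of i p]
      show "flat ([:0, 0, 1:] * (p - pderiv p)) (f x) * pd i f x = pd i (\<lambda>x. flat p (f x)) x"
        by (simp add: pd_def)
    qed
  qed
qed

lemma smooth_on_component: "smooth_on UNIV (\<lambda>x. x $ k :: real)"
proof -
  have "pd i (\<lambda>x. x $ k) = (\<lambda>x. axis i 1 $ k :: real)" for i
    by (rule ext, rule pd_eqI[OF bounded_linear_imp_has_derivative[OF bounded_linear_vec_nth]])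
  moreover have "(\<lambda>x. x $ k :: real) differentiable (at x)" for x
    by (rule bounded_linear_imp_differentiable[OF bounded_linear_vec_nth])
  ultimately have "diff_upto n UNIV (\<lambda>x. x $ k :: real)" for n
    by (cases n) auto
  then show ?thesis
    by (simp add: smooth_on_iff_diff_upto)
qed

lemma smooth_on_dist_squared: "smooth_on UNIV (\<lambda>x. (dist a x)\<^sup>2)"
proof -
  have eq: "(dist a x)\<^sup>2 = (\<Sum>k\<in>UNIV. (a $ k - x $ k) * (a $ k - x $ k))" for x :: "real^2"
    by (simp add: dist_norm power2_norm_eq_inner inner_vec_def)
  show ?thesis
    unfolding eq
    by (intro smooth_on_sum smooth_on_mult smooth_on_diff smooth_on_const smooth_on_component open_UNIV)
qed

text \<open>The usual quotient \<open>g / (g + h)\<close>, where \<open>g\<close> is positive exactly inside the ball of radius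
  \<open>R\<close> and \<open>h\<close> exactly outside the closed ball of radius \<open>\<rho>\<close>, so that the
  denominator never vanishes.\<close>

lemma exists_cutoff:
  assumes "0 < \<rho>" "\<rho> < R"
  obtains \<eta> :: "real^2 \<Rightarrow> real" where "smooth_on UNIV \<eta>" "\<And>x. 0 \<le> \<eta> x"
    "\<And>x. dist a x \<le> \<rho> \<Longrightarrow> \<eta> x = 1" "\<And>x. R \<le> dist a x \<Longrightarrow> \<eta> x = 0"
proof
  let ?g = "\<lambda>x. flat 1 (R\<^sup>2 - (dist a x)\<^sup>2)"
  let ?h = "\<lambda>x. flat 1 ((dist a x)\<^sup>2 - \<rho>\<^sup>2)"
  let ?\<eta> = "\<lambda>x. ?g x * inverse (?g x + ?h x)"
  have ge0: "flat 1 t \<ge> 0" and gt0: "flat 1 t > 0 \<longleftrightarrow> t > 0" and eq0: "t \<le> 0 \<Longrightarrow> flat 1 t = 0" for t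
    by (auto simp: flat_def)
  have pos: "?g x + ?h x > 0" for x
  proof (cases "dist a x < R")
    case True
    then have "?g x > 0"
      by (simp add: gt0 power_strict_mono)
    then show ?thesis using ge0 by (simp add: add_pos_nonneg)
  next
    case False
    then have "?h x > 0"
      using assms by (simp add: gt0 power_strict_mono)
    then show ?thesis using ge0 by (simp add: add_nonneg_pos)
  qed
  have sm: "smooth_on UNIV ?g" "smooth_on UNIV ?h"
    unfolding smooth_on_iff_diff_upto
    by (intro allI diff_upto_flat open_UNIV smooth_on_diff[OF open_UNIV, THEN smooth_on_iff_diff_upto[THEN iffD1], rule_format]
        smooth_on_const smooth_on_dist_squared)+
  show "smooth_on UNIV ?\<eta>"
    by (intro smooth_on_mult smooth_on_inverse smooth_on_add sm open_UNIV) (metis pos less_irrefl)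
  show "0 \<le> ?\<eta> x" for x
    using pos[of x] ge0 by simp
  show "?\<eta> x = 1" if "dist a x \<le> \<rho>" for x
  proof -
    have "?h x = 0" by (rule eq0) (use that in \<open>simp add: power_mono\<close>)
    then show ?thesis using pos[of x] by simp
  qed
  show "?\<eta> x = 0" if "R \<le> dist a x" for x
    by (subst eq0) (use that assms in \<open>auto simp: power_mono\<close>)
qed

section \<open>Integration by parts and the fundamental lemma\<close>

lemma test_fun_bounded:
  fixes \<phi> :: "real^2 \<Rightarrow> real"
  assumes "\<phi> \<in> test_fun U"
  obtains M where "M \<ge> 0" "\<And>x. \<bar>\<phi> x\<bar> \<le> M"
proof -
  have "continuous_on (supp \<phi>) \<phi>"
    using smooth_on_continuous_on[OF smooth_on_subset[OF test_funD(1)[OF assms]]] by simp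
  then have "bounded (\<phi> ` supp \<phi>)"
    using compact_continuous_image compact_imp_bounded test_funD(2)[OF assms] by blast
  then obtain M where M: "M > 0" "\<And>x. x \<in> supp \<phi> \<Longrightarrow> \<bar>\<phi> x\<bar> \<le> M"
    by (auto simp: bounded_pos)
  then have "\<bar>\<phi> x\<bar> \<le> M" for x
    by (cases "x \<in> supp \<phi>") (auto simp: zero_outside_supp)
  with M show ?thesis using that[of M] by auto
qed

lemma test_fun_integrable:
  fixes \<phi> :: "real^2 \<Rightarrow> real"
  assumes "\<phi> \<in> test_fun U"
  shows "integrable lborel \<phi>"
proof -
  have "continuous_on (supp \<phi>) \<phi>"
    using smooth_on_continuous_on[OF smooth_on_subset[OF test_funD(1)[OF assms]]] by simp
  from borel_integrable_compact[OF test_funD(2)[OF assms] this]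
  moreover have "(\<lambda>x. indicator (supp \<phi>) x *\<^sub>R \<phi> x) = \<phi>"
    by (auto simp: fun_eq_iff indicator_def zero_outside_supp)
  ultimately show ?thesis by simp
qed

lemma integral_translation_lborel:
  fixes f :: "'a::euclidean_space \<Rightarrow> real"
  assumes "f \<in> borel_measurable borel"
  shows "(LINT x|lborel. f (c + x)) = (LINT x|lborel. f x)"
proof -
  have "(LINT x|lborel. f x) = (LINT x|distr lborel borel ((+) c). f x)"
    by (simp add: lborel_distr_plus)
  also have "\<dots> = (LINT x|lborel. f (c + x))"
    by (rule integral_distr) (use assms in auto)
  finally show ?thesis by simp
qed

text \<open>Difference quotients of a test function integrate to zero because Lebesgue measure is invariant
  under translations. They converge to the partial derivative, dominated by a constant on a fixed
  ball.\<close>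

lemma integral_pd_eq_0:
  fixes \<phi> :: "real^2 \<Rightarrow> real"
  assumes "\<phi> \<in> test_fun UNIV"
  shows "(LINT x|lborel. pd i \<phi> x) = 0"
proof -
  let ?e = "axis i 1 :: real^2"
  let ?h = "\<lambda>n. 1 / real (Suc n)"
  define q where "q n x = (\<phi> (?h n *\<^sub>R ?e + x) - \<phi> x) / ?h n" for n x
  have int: "integrable lborel \<phi>"
    by (rule test_fun_integrable[OF assms])
  have diff: "\<phi> differentiable (at x)" for x
    using smooth_on_differentiable[OF test_funD(1)[OF assms]] by simp
  have cont: "continuous_on UNIV \<phi>"
    by (rule smooth_on_continuous_on[OF test_funD(1)[OF assms]])
  then have meas: "\<phi> \<in> borel_measurable borel"
    by (rule borel_measurable_continuous_onI)
  obtain M where M: "\<And>x. \<bar>pd i \<phi> x\<bar> \<le> M"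
    using test_fun_bounded[OF test_fun_pd[OF assms]] by metis
  obtain B where B: "\<And>x. x \<in> supp \<phi> \<Longrightarrow> norm x \<le> B"
    using compact_imp_bounded[OF test_funD(2)[OF assms]] by (auto simp: bounded_iff)
  let ?K = "cball 0 (B + 1) :: (real^2) set"
  have bound: "\<bar>q n x\<bar> \<le> M * indicator ?K x" for n x
  proof (cases "x \<in> ?K")
    case True
    have hn: "0 < ?h n" by simp
    obtain s where "\<phi> (x + ?h n *\<^sub>R ?e) - \<phi> (x + 0 *\<^sub>R ?e) = (?h n - 0) * pd i \<phi> (x + s *\<^sub>R ?e)"
      using MVT2[OF hn has_real_derivative_along_axis[OF diff, of x i]] by blast
    then have "q n x = pd i \<phi> (x + s *\<^sub>R ?e)"
      by (simp add: q_def add_ac del: of_nat_Suc)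
    then show ?thesis using True M by simp
  next
    case False
    then have nx: "norm x > B + 1" by simp
    define v where "v = ?h n *\<^sub>R ?e"
    have "norm v \<le> 1"
      by (simp add: v_def norm_axis_1)
    moreover have "norm x \<le> norm (v + x) + norm v"
      using norm_triangle_ineq4[of "v + x" v] by simp
    ultimately have "norm (?h n *\<^sub>R ?e + x) > B"
      using nx unfolding v_def by linarith
    then have "\<phi> (?h n *\<^sub>R ?e + x) = 0" "\<phi> x = 0"
      using nx B by (force intro!: zero_outside_supp)+
    then show ?thesis using False by (simp add: q_def)
  qed
  have lim: "(\<lambda>n. q n x) \<longlonglongrightarrow> pd i \<phi> x" for x
  proof -
    have "((\<lambda>s. (\<phi> (x + (0 + s) *\<^sub>R ?e) - \<phi> (x + 0 *\<^sub>R ?e)) / s) \<longlongrightarrow> pd i \<phi> (x + 0 *\<^sub>R ?e)) (at 0)"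
      using has_real_derivative_along_axis[OF diff, of x i 0] unfolding DERIV_def .
    moreover have "filterlim ?h (at 0) sequentially"
      unfolding filterlim_at using LIMSEQ_Suc[OF lim_1_over_n] by (auto simp del: of_nat_Suc)
    ultimately have "(\<lambda>n. (\<phi> (x + (0 + ?h n) *\<^sub>R ?e) - \<phi> (x + 0 *\<^sub>R ?e)) / ?h n) \<longlonglongrightarrow> pd i \<phi> (x + 0 *\<^sub>R ?e)"
      by (rule filterlim_compose)
    then show ?thesis
      by (simp add: q_def add_ac del: of_nat_Suc)
  qed
  have int': "integrable lborel (\<lambda>x. \<phi> (c + x))" for c
    using integrable_distr[of "(+) c" lborel borel \<phi>] int by (simp add: lborel_distr_plus)
  have "(LINT x|lborel. q n x) = 0" for n
    unfolding q_def using int int' by (simp add: integral_translation_lborel[OF meas] del: of_nat_Suc)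
  moreover have "(\<lambda>n. LINT x|lborel. q n x) \<longlonglongrightarrow> (LINT x|lborel. pd i \<phi> x)"
  proof (rule integral_dominated_convergence)
    show "integrable lborel (\<lambda>x. M * indicator ?K x)"
      using emeasure_compact_finite[of ?K] by (intro integrable_mult_right integrable_real_indicator) auto
    show "q n \<in> borel_measurable lborel" for n
      unfolding q_def using meas by measurable
    show "pd i \<phi> \<in> borel_measurable lborel"
      using test_fun_integrable[OF test_fun_pd[OF assms]] by auto
  qed (use lim bound in auto)
  ultimately show ?thesis
    by (simp add: LIMSEQ_const_iff)
qed

lemma set_integral_test_fun:
  fixes \<phi> :: "real^2 \<Rightarrow> real"
  assumes "\<phi> \<in> test_fun U"
  shows "(LINT x:U|lborel. f x * \<phi> x) = (LINT x|lborel. f x * \<phi> x)"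
  unfolding set_lebesgue_integral_def
  by (rule Bochner_Integration.integral_cong) (auto simp: indicator_def test_fun_zero_outside[OF assms])

lemma integrable_smooth_mult_test_fun:
  fixes f \<phi> :: "real^2 \<Rightarrow> real"
  assumes "open U" "smooth_on U f" "\<phi> \<in> test_fun U"
  shows "integrable lborel (\<lambda>x. f x * \<phi> x)"
  by (rule test_fun_integrable[OF test_fun_smooth_mult[OF assms test_funD(3)[OF assms(3)]]])

lemma integration_by_parts:
  fixes f \<phi> :: "real^2 \<Rightarrow> real"
  assumes "open U" "smooth_on U f" "\<phi> \<in> test_fun U"
  shows "(LINT x|lborel. pd i f x * \<phi> x) = - (LINT x|lborel. f x * pd i \<phi> x)"
proof -
  let ?u = "\<lambda>x. f x * \<phi> x"
  have u: "?u \<in> test_fun U"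
    by (rule test_fun_smooth_mult[OF assms test_funD(3)[OF assms(3)]])
  have "pd i ?u x = f x * pd i \<phi> x + pd i f x * \<phi> x" for x
  proof (cases "x \<in> supp \<phi>")
    case True
    then show ?thesis
      using assms smooth_on_differentiable test_funD[OF assms(3)] by (intro pd_mult) blast+
  next
    case False
    moreover have "supp ?u \<subseteq> supp \<phi>"
      by (rule supp_subset_closed[OF closed_supp]) (simp add: zero_outside_supp)
    ultimately show ?thesis
      using pd_zero_outside_supp[of x ?u i] pd_zero_outside_supp[of x \<phi> i] by (auto simp: zero_outside_supp)
  qed
  then have "(LINT x|lborel. f x * pd i \<phi> x + pd i f x * \<phi> x) = 0"
    using integral_pd_eq_0[OF test_fun_mono[OF u], of i] by simp
  moreover have "integrable lborel (\<lambda>x. f x * pd i \<phi> x)" "integrable lborel (\<lambda>x. pd i f x * \<phi> x)"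
    using assms by (auto intro!: integrable_smooth_mult_test_fun test_fun_pd smooth_on_pd)
  ultimately show ?thesis by simp
qed

text \<open>If \<open>f a \<noteq> 0\<close>, then \<open>f a * f x \<ge> (f a)\<^sup>2 / 2\<close> for \<open>x\<close> near \<open>a\<close>, and testing
  \<open>f\<close> with a cutoff concentrated there gives a nonzero integral.\<close>

lemma smooth_eq_0_of_integrals:
  fixes f :: "real^2 \<Rightarrow> real"
  assumes "open U" "smooth_on U f" and zero: "\<And>\<phi>. \<phi> \<in> test_fun U \<Longrightarrow> (LINT x|lborel. f x * \<phi> x) = 0"
    and "a \<in> U"
  shows "f a = 0"
proof (rule ccontr)
  assume nz: "f a \<noteq> 0"
  obtain d1 where d1: "d1 > 0" "\<And>x. dist x a < d1 \<Longrightarrow> dist (f x) (f a) < \<bar>f a\<bar> / 2"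
    using smooth_on_continuous[OF assms(2,4)] nz unfolding continuous_at_eps_delta
    by (metis half_gt_zero zero_less_abs_iff)
  obtain d2 where d2: "d2 > 0" "cball a d2 \<subseteq> U"
    using assms(1,4) open_contains_cball by blast
  define R where "R = min (d1/2) d2"
  have R: "R > 0" "R < d1" "R \<le> d2"
    using d1 d2 by (auto simp: R_def)
  obtain \<eta> :: "real^2 \<Rightarrow> real" where \<eta>: "smooth_on UNIV \<eta>" "\<And>x. 0 \<le> \<eta> x"
    "\<And>x. dist a x \<le> R / 2 \<Longrightarrow> \<eta> x = 1" "\<And>x. R \<le> dist a x \<Longrightarrow> \<eta> x = 0"
    using exists_cutoff[of "R/2" R a] R by auto
  have test: "\<eta> \<in> test_fun U"
    by (rule test_funI[of _ "cball a R"]) (use \<eta> d2 R in auto)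
  have int: "integrable lborel (\<lambda>x. f x * \<eta> x)"
    by (rule integrable_smooth_mult_test_fun[OF assms(1,2) test])
  let ?b = "ball a (R/2)"
  \<comment> \<open>the product with \<open>f a\<close> treats both signs of \<open>f a\<close> at once\<close>
  have lower: "(f a)\<^sup>2 / 2 * indicator ?b x \<le> f a * (f x * \<eta> x)" for x
  proof (cases "dist a x < R")
    case True
    then have "\<bar>f x - f a\<bar> < \<bar>f a\<bar> / 2"
      using d1(2)[of x] R by (simp add: dist_commute dist_real_def abs_minus_commute)
    then have "\<bar>f a\<bar> * \<bar>f a - f x\<bar> \<le> \<bar>f a\<bar> * (\<bar>f a\<bar> / 2)"
      by (intro mult_left_mono) (auto simp: abs_minus_commute)
    then have "f a * (f a - f x) \<le> (f a)\<^sup>2 / 2"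
      using abs_ge_self[of "f a * (f a - f x)"] by (simp add: abs_mult power2_eq_square)
    then have *: "(f a)\<^sup>2 / 2 \<le> f a * f x"
      by (simp add: algebra_simps power2_eq_square)
    show ?thesis
    proof (cases "x \<in> ?b")
      case True
      then show ?thesis using \<eta>(3)[of x] * by simp
    next
      case False
      have "0 \<le> f a * f x * \<eta> x"
        using order_trans[OF _ *, of 0] \<eta>(2)[of x] by (intro mult_nonneg_nonneg[of "f a * f x"]) simp_all
      then show ?thesis using False by (simp add: mult.assoc)
    qed
  next
    case False
    then show ?thesis using \<eta>(4)[of x] R by auto
  qed
  have "0 < (f a)\<^sup>2 / 2 * measure lborel ?b"
    using nz R content_ball_pos[of "R/2" a] by (simp add: measure_completion)
  also have "\<dots> = (LINT x|lborel. (f a)\<^sup>2 / 2 * indicator ?b x)"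
    by simp
  also have "\<dots> \<le> (LINT x|lborel. f a * (f x * \<eta> x))"
    using int lower emeasure_bounded_finite[of ?b]
    by (intro integral_mono integrable_mult_right integrable_real_indicator) auto
  also have "\<dots> = 0"
    using zero[OF test] by simp
  finally show False by simp
qed

section \<open>Linear functionals on test functions\<close>

definition linear_on_tests :: "(real^2) set \<Rightarrow> dist \<Rightarrow> bool" where
  "linear_on_tests U T \<longleftrightarrow>
     (\<forall>\<phi>\<in>test_fun U. \<forall>\<psi>\<in>test_fun U. T (\<lambda>x. \<phi> x + \<psi> x) = T \<phi> + T \<psi>) \<and>
     (\<forall>c. \<forall>\<phi>\<in>test_fun U. T (\<lambda>x. c * \<phi> x) = c * T \<phi>)"

lemma linear_on_tests_add:
  "linear_on_tests U T \<Longrightarrow> \<phi> \<in> test_fun U \<Longrightarrow> \<psi> \<in> test_fun U \<Longrightarrow> T (\<lambda>x. \<phi> x + \<psi> x) = T \<phi> + T \<psi>"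
  by (simp add: linear_on_tests_def)

lemma linear_on_tests_cmult:
  "linear_on_tests U T \<Longrightarrow> \<phi> \<in> test_fun U \<Longrightarrow> T (\<lambda>x. c * \<phi> x) = c * T \<phi>"
  by (simp add: linear_on_tests_def)

lemma linear_on_tests_zero: "linear_on_tests U T \<Longrightarrow> T (\<lambda>x. 0) = 0"
  using linear_on_tests_cmult[of U T "\<lambda>x. 0" 0] by simp

lemma linear_on_tests_diff:
  assumes "linear_on_tests U T" "\<phi> \<in> test_fun U" "\<psi> \<in> test_fun U"
  shows "T (\<lambda>x. \<phi> x - \<psi> x) = T \<phi> - T \<psi>"
  using linear_on_tests_add[OF assms(1,2) test_fun_cmult[OF assms(3), of "-1"]]
    linear_on_tests_cmult[OF assms(1,3), of "-1"] by simp

lemma linear_on_tests_sum: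
  assumes "linear_on_tests U T" "\<And>a. a \<in> A \<Longrightarrow> \<phi> a \<in> test_fun U"
  shows "T (\<lambda>x. \<Sum>a\<in>A. c a * \<phi> a x) = (\<Sum>a\<in>A. c a * T (\<phi> a))"
  using assms(2)
proof (induction A rule: infinite_finite_induct)
  case (insert a A)
  then show ?case
    using linear_on_tests_add[OF assms(1), of "\<lambda>x. c a * \<phi> a x" "\<lambda>x. \<Sum>a\<in>A. c a * \<phi> a x"]
    by (simp add: test_fun_cmult test_fun_sum linear_on_tests_cmult[OF assms(1)])
qed (simp_all add: linear_on_tests_zero[OF assms(1)])

lemma linear_on_tests_mono: "linear_on_tests U T \<Longrightarrow> V \<subseteq> U \<Longrightarrow> linear_on_tests V T"
  unfolding linear_on_tests_def by (meson test_fun_mono)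

lemma linear_on_tests_minus:
  "linear_on_tests U S \<Longrightarrow> linear_on_tests U T \<Longrightarrow> linear_on_tests U (\<lambda>\<phi>. S \<phi> - T \<phi>)"
  by (simp add: linear_on_tests_def algebra_simps)

lemma linear_on_tests_plus:
  "linear_on_tests U S \<Longrightarrow> linear_on_tests U T \<Longrightarrow> linear_on_tests U (\<lambda>\<phi>. S \<phi> + T \<phi>)"
  by (simp add: linear_on_tests_def algebra_simps)

lemma linear_on_tests_pd:
  assumes "linear_on_tests U T"
  shows "linear_on_tests U (\<lambda>\<phi>. T (pd i \<phi>))"
  unfolding linear_on_tests_def
proof (intro conjI ballI allI)
  fix \<phi> \<psi> :: "real^2 \<Rightarrow> real" assume "\<phi> \<in> test_fun U" "\<psi> \<in> test_fun U"
  then show "T (pd i (\<lambda>x. \<phi> x + \<psi> x)) = T (pd i \<phi>) + T (pd i \<psi>)"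
    by (simp add: smooth_pd_add test_funD(1) linear_on_tests_add[OF assms] test_fun_pd)
next
  fix c and \<phi> :: "real^2 \<Rightarrow> real" assume "\<phi> \<in> test_fun U"
  then show "T (pd i (\<lambda>x. c * \<phi> x)) = c * T (pd i \<phi>)"
    by (simp add: smooth_pd_cmult test_funD(1) linear_on_tests_cmult[OF assms] test_fun_pd)
qed

lemma linear_on_tests_integral:
  assumes "open U" "smooth_on U f"
  shows "linear_on_tests U (\<lambda>\<phi>. LINT x|lborel. f x * \<phi> x)"
  unfolding linear_on_tests_def
proof (intro conjI ballI allI)
  fix \<phi> \<psi> :: "real^2 \<Rightarrow> real" assume "\<phi> \<in> test_fun U" "\<psi> \<in> test_fun U"
  then show "(LINT x|lborel. f x * (\<phi> x + \<psi> x)) = (LINT x|lborel. f x * \<phi> x) + (LINT x|lborel. f x * \<psi> x)"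
    by (simp add: distrib_left integrable_smooth_mult_test_fun[OF assms])
next
  fix c and \<phi> :: "real^2 \<Rightarrow> real" assume "\<phi> \<in> test_fun U"
  then show "(LINT x|lborel. f x * (c * \<phi> x)) = c * (LINT x|lborel. f x * \<phi> x)"
    by (simp add: mult.left_commute)
qed

text \<open>Instead of a partition of unity, finitely many cutoffs \<open>\<eta> x\<close>, each supported where \<open>T\<close> vanishes
  and equal to \<open>1\<close> on balls covering the support of \<open>\<phi>\<close>, are removed one after the other.
  Replacing \<open>\<psi>\<close> by \<open>(1 - \<eta> x) \<psi>\<close> does not change the value of \<open>T\<close>, and after all
  replacements nothing is left of \<open>\<phi>\<close>.\<close>

lemma eq_0_if_locally_eq_0:
  assumes lin: "linear_on_tests U T"
    and loc: "\<And>x. x \<in> U \<Longrightarrow> \<exists>V. open V \<and> x \<in> V \<and> (\<forall>\<phi>\<in>test_fun V. T \<phi> = 0)"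
    and \<phi>: "\<phi> \<in> test_fun U"
  shows "T \<phi> = 0"
proof -
  have "\<exists>r \<eta>. r > 0 \<and> smooth_on UNIV \<eta> \<and> (\<forall>y\<in>ball x r. \<eta> y = 1) \<and>
      (\<forall>\<psi>. smooth_on UNIV \<psi> \<longrightarrow> T (\<lambda>y. \<eta> y * \<psi> y) = 0)" if "x \<in> supp \<phi>" for x
  proof -
    have "x \<in> U"
      using that test_funD(3)[OF \<phi>] by blast
    from loc[OF this] obtain V where V: "open V" "x \<in> V" "\<And>\<phi>. \<phi> \<in> test_fun V \<Longrightarrow> T \<phi> = 0"
      by blast
    obtain R where R: "R > 0" "cball x R \<subseteq> V"
      using V open_contains_cball by blast
    obtain \<eta> :: "real^2 \<Rightarrow> real" where \<eta>: "smooth_on UNIV \<eta>"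
      "\<And>y. 0 \<le> \<eta> y" "\<And>y. dist x y \<le> R / 2 \<Longrightarrow> \<eta> y = 1" "\<And>y. R \<le> dist x y \<Longrightarrow> \<eta> y = 0"
      using exists_cutoff[of "R/2" R x] R by auto
    have "T (\<lambda>y. \<eta> y * \<psi> y) = 0" if "smooth_on UNIV \<psi>" for \<psi>
    proof (rule V(3), rule test_funI[of _ "cball x R"])
      show "smooth_on UNIV (\<lambda>y. \<eta> y * \<psi> y)"
        by (rule smooth_on_mult[OF open_UNIV \<eta>(1) that])
    qed (use R \<eta> in auto)
    then show ?thesis
      using R \<eta> by (intro exI[of _ "R/2"] exI[of _ \<eta>]) auto
  qed
  then have "\<forall>x\<in>supp \<phi>. \<exists>r \<eta>. r > 0 \<and> smooth_on UNIV \<eta> \<and> (\<forall>y\<in>ball x r. \<eta> y = 1) \<and>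
      (\<forall>\<psi>. smooth_on UNIV \<psi> \<longrightarrow> T (\<lambda>y. \<eta> y * \<psi> y) = 0)"
    by blast
  then obtain r where "\<forall>x\<in>supp \<phi>. \<exists>\<eta>. r x > 0 \<and> smooth_on UNIV \<eta> \<and> (\<forall>y\<in>ball x (r x). \<eta> y = 1) \<and>
      (\<forall>\<psi>. smooth_on UNIV \<psi> \<longrightarrow> T (\<lambda>y. \<eta> y * \<psi> y) = 0)"
    by (rule bchoice[THEN exE])
  then obtain \<eta> where "\<forall>x\<in>supp \<phi>. r x > 0 \<and> smooth_on UNIV (\<eta> x) \<and> (\<forall>y\<in>ball x (r x). \<eta> x y = 1) \<and>
      (\<forall>\<psi>. smooth_on UNIV \<psi> \<longrightarrow> T (\<lambda>y. \<eta> x y * \<psi> y) = 0)"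
    by (rule bchoice[THEN exE])
  then have r: "\<And>x. x \<in> supp \<phi> \<Longrightarrow> r x > 0"
    and \<eta>: "\<And>x. x \<in> supp \<phi> \<Longrightarrow> smooth_on UNIV (\<eta> x)"
      "\<And>x y. x \<in> supp \<phi> \<Longrightarrow> y \<in> ball x (r x) \<Longrightarrow> \<eta> x y = (1::real)"
      "\<And>x \<psi>. x \<in> supp \<phi> \<Longrightarrow> smooth_on UNIV \<psi> \<Longrightarrow> T (\<lambda>y. \<eta> x y * \<psi> y) = 0"
    by blast+
  obtain F where F: "F \<subseteq> supp \<phi>" "finite F" "supp \<phi> \<subseteq> (\<Union>x\<in>F. ball x (r x))"
    using compactE_image[OF test_funD(2)[OF \<phi>], of "supp \<phi>" "\<lambda>x. ball x (r x)"] r by force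
  have "(\<lambda>y. (\<Prod>x\<in>F. 1 - \<eta> x y) * \<phi> y) \<in> test_fun U \<and> T (\<lambda>y. (\<Prod>x\<in>F. 1 - \<eta> x y) * \<phi> y) = T \<phi>"
    using F(2,1)
  proof (induction F)
    case empty
    then show ?case using \<phi> by simp
  next
    case (insert a F)
    let ?g = "\<lambda>y. (\<Prod>x\<in>F. 1 - \<eta> x y) * \<phi> y"
    have g: "?g \<in> test_fun U" "T ?g = T \<phi>" and a: "a \<in> supp \<phi>"
      using insert by auto
    have ag: "(\<lambda>y. \<eta> a y * ?g y) \<in> test_fun U"
      by (rule test_fun_smooth_mult[OF open_UNIV \<eta>(1)[OF a] g(1)]) simp
    have eq: "(\<lambda>y. (\<Prod>x\<in>insert a F. 1 - \<eta> x y) * \<phi> y) = (\<lambda>y. ?g y - \<eta> a y * ?g y)"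
      using insert.hyps by (simp add: fun_eq_iff algebra_simps)
    show ?case
      unfolding eq linear_on_tests_diff[OF lin g(1) ag] g(2)
      using test_fun_diff[OF g(1) ag] \<eta>(3)[OF a test_funD(1)[OF g(1)]] by simp
  qed
  moreover have "(\<lambda>y. (\<Prod>x\<in>F. 1 - \<eta> x y) * \<phi> y) = (\<lambda>y. 0)"
  proof
    fix y
    show "(\<Prod>x\<in>F. 1 - \<eta> x y) * \<phi> y = 0"
    proof (cases "y \<in> supp \<phi>")
      case True
      then obtain x where "x \<in> F" "y \<in> ball x (r x)"
        using F(3) by blast
      then show ?thesis using \<eta>(2)[of x y] F by auto
    qed (simp add: zero_outside_supp)
  qed
  ultimately show ?thesis
    using linear_on_tests_zero[OF lin] by simp
qed

section \<open>Smooth densities off the singular support\<close>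

lemma given_by_iff:
  "given_by U T f \<longleftrightarrow> smooth_on U f \<and> (\<forall>\<phi>\<in>test_fun U. T \<phi> = (LINT x|lborel. f x * \<phi> x))"
  by (simp add: given_by_def set_integral_test_fun)

lemma given_by_mono: "given_by U T f \<Longrightarrow> V \<subseteq> U \<Longrightarrow> given_by V T f"
  unfolding given_by_iff by (meson smooth_on_subset test_fun_mono)

lemma given_by_unique:
  assumes "open U" "given_by U T f" "given_by U T g" "x \<in> U"
  shows "f x = g x"
proof -
  have sm: "smooth_on U f" "smooth_on U g"
    using assms by (auto simp: given_by_iff)
  have "f x - g x = 0"
  proof (rule smooth_eq_0_of_integrals[OF assms(1) smooth_on_diff[OF assms(1) sm] _ assms(4)])
    fix \<phi> :: "real^2 \<Rightarrow> real" assume \<phi>: "\<phi> \<in> test_fun U"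
    then have "(LINT x|lborel. f x * \<phi> x) = (LINT x|lborel. g x * \<phi> x)"
      using assms by (simp add: given_by_iff)
    then show "(LINT x|lborel. (f x - g x) * \<phi> x) = 0"
      using integrable_smooth_mult_test_fun[OF assms(1) sm(1) \<phi>]
        integrable_smooth_mult_test_fun[OF assms(1) sm(2) \<phi>] by (simp add: left_diff_distrib)
  qed
  then show ?thesis by simp
qed

lemma given_by_cong:
  assumes "open U" "given_by U T f" "\<And>x. x \<in> U \<Longrightarrow> f x = g x"
  shows "given_by U T g"
proof -
  have "(LINT x|lborel. f x * \<phi> x) = (LINT x|lborel. g x * \<phi> x)" if "\<phi> \<in> test_fun U" for \<phi> :: "real^2 \<Rightarrow> real"
    using assms(3) test_fun_zero_outside[OF that] by (metis mult_zero_right)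
  then show ?thesis
    using assms smooth_on_cong_open[OF assms(1,3)] by (auto simp: given_by_iff)
qed

text \<open>Local densities agree on overlaps by uniqueness, so they define a global one; the two functionals
  it has to reconcile agree locally, hence globally.\<close>

lemma given_by_glue:
  assumes "open U" "linear_on_tests U T"
    and loc: "\<And>x. x \<in> U \<Longrightarrow> \<exists>V f. open V \<and> x \<in> V \<and> V \<subseteq> U \<and> given_by V T f"
  shows "\<exists>f. given_by U T f"
proof -
  obtain V F where V: "\<And>x. x \<in> U \<Longrightarrow> open (V x)" "\<And>x. x \<in> U \<Longrightarrow> x \<in> V x" "\<And>x. x \<in> U \<Longrightarrow> V x \<subseteq> U"
    "\<And>x. x \<in> U \<Longrightarrow> given_by (V x) T (F x)"
    using loc by metis
  \<comment> \<open>the value at \<open>y\<close> of the local density chosen for \<open>y\<close> itself\<close>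
  define f where "f y = F y y" for y
  have f: "given_by (V x) T f" if x: "x \<in> U" for x
  proof (rule given_by_cong[OF V(1,4)[OF x]])
    fix y assume y: "y \<in> V x"
    then have yU: "y \<in> U" using V(3) x by blast
    show "F x y = f y"
      unfolding f_def
      by (rule given_by_unique[of "V x \<inter> V y" T "F x" "F y" y])
        (use x y yU V in \<open>auto intro: given_by_mono[of "V x"] given_by_mono[of "V y"]\<close>)
  qed
  have smooth: "smooth_on U f"
    using f V(2) unfolding smooth_on_def given_by_iff by blast
  have "T \<phi> - (LINT x|lborel. f x * \<phi> x) = 0" if "\<phi> \<in> test_fun U" for \<phi>
  proof (rule eq_0_if_locally_eq_0[OF _ _ that])
    show "linear_on_tests U (\<lambda>\<phi>. T \<phi> - (LINT x|lborel. f x * \<phi> x))"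
      by (intro linear_on_tests_minus assms linear_on_tests_integral smooth)
  next
    fix x assume x: "x \<in> U"
    show "\<exists>V. open V \<and> x \<in> V \<and> (\<forall>\<phi>\<in>test_fun V. T \<phi> - (LINT x|lborel. f x * \<phi> x) = 0)"
      using V[OF x] f[OF x] by (intro exI[of _ "V x"]) (auto simp: given_by_iff)
  qed
  then have "given_by U T f"
    using smooth by (simp add: given_by_iff)
  then show ?thesis by (rule exI[of _ f])
qed

lemma linear_on_tests_\<A>: "T \<in> \<A> \<Omega> \<Longrightarrow> linear_on_tests \<Omega> T"
  by (simp add: \<A>_def distribution_on_def linear_on_tests_def)

text \<open>Off the origin there are only local densities by the condition on the singular support; gluing
  turns them into the single density that the choice operator in the representative requires.\<close>

lemma given_by_smooth_rep:
  assumes "open \<Omega>" "T \<in> \<A> \<Omega>"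
  shows "given_by (\<Omega> - {0}) T (smooth_rep (\<Omega> - {0}) T)"
proof -
  have "\<exists>f. given_by (\<Omega> - {0}) T f"
  proof (rule given_by_glue)
    fix x assume x: "x \<in> \<Omega> - {0}"
    then have "x \<notin> sing_supp \<Omega> T"
      using assms(2) by (auto simp: \<A>_def)
    then obtain U f where U: "open U" "x \<in> U" "U \<subseteq> \<Omega>" "given_by U T f"
      using x by (auto simp: sing_supp_def)
    then show "\<exists>V f. open V \<and> x \<in> V \<and> V \<subseteq> \<Omega> - {0} \<and> given_by V T f"
      using x by (intro exI[of _ "U - {0}"] exI[of _ f]) (auto intro: given_by_mono)
  qed (use assms linear_on_tests_mono[OF linear_on_tests_\<A>] in auto)
  then show ?thesis
    unfolding smooth_rep_def by (rule someI_ex)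
qed

section \<open>Classical and distributional incompatibility\<close>

lemma Curl_Curl_eq:
  "Curl (Curl_tensor E) \<phi> = (E$2$2) (pd 1 (pd 1 \<phi>)) - (E$2$1) (pd 2 (pd 1 \<phi>))
    - (E$1$2) (pd 1 (pd 2 \<phi>)) + (E$1$1) (pd 2 (pd 2 \<phi>))"
  by (simp add: Curl_def Curl_tensor_def dist_pd_def)

lemma linear_on_tests_Curl_Curl:
  assumes "\<And>i j. linear_on_tests U (E$i$j)"
  shows "linear_on_tests U (Curl (Curl_tensor E))"
  using assms unfolding Curl_Curl_eq[abs_def]
  by (intro linear_on_tests_plus linear_on_tests_minus linear_on_tests_pd[where T="\<lambda>\<phi>. S (pd i \<phi>)" for S i] linear_on_tests_pd)

lemma integration_by_parts_curl:
  fixes a b \<phi> :: "real^2 \<Rightarrow> real"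
  assumes "open U" "smooth_on U a" "smooth_on U b" "\<phi> \<in> test_fun U"
  shows "(LINT x|lborel. (pd 1 a x - pd 2 b x) * \<phi> x)
    = - (LINT x|lborel. a x * pd 1 \<phi> x) + (LINT x|lborel. b x * pd 2 \<phi> x)"
  using integration_by_parts[OF assms(1,2,4), of 1] integration_by_parts[OF assms(1,3,4), of 2]
    integrable_smooth_mult_test_fun[OF assms(1) smooth_on_pd[OF assms(2)] assms(4), of 1]
    integrable_smooth_mult_test_fun[OF assms(1) smooth_on_pd[OF assms(3)] assms(4), of 2]
  by (simp add: left_diff_distrib)

text \<open>Two integrations by parts move the classical derivatives onto the test function.\<close>

lemma Curl_Curl_given_by:
  assumes "open U" and E: "\<And>i j. given_by U (E$i$j) (\<lambda>x. F x $ i $ j)"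
  shows "given_by U (Curl (Curl_tensor E)) (curl (curl_tensor F))"
proof -
  have sm: "smooth_on U (\<lambda>x. F x $ i $ j)" for i j
    using E by (simp add: given_by_iff)
  define v where "v i x = pd 1 (\<lambda>y. F y $ i $ 2) x - pd 2 (\<lambda>y. F y $ i $ 1) x" for i x
  have v: "smooth_on U (v i)" for i
    unfolding v_def by (intro smooth_on_diff smooth_on_pd sm assms)
  have cc: "curl (curl_tensor F) = (\<lambda>x. pd 1 (v 2) x - pd 2 (v 1) x)"
    by (simp add: curl_def curl_tensor_def v_def[abs_def] fun_eq_iff)
  have "smooth_on U (curl (curl_tensor F))"
    unfolding cc by (intro smooth_on_diff smooth_on_pd v assms)
  moreover have "Curl (Curl_tensor E) \<phi> = (LINT x|lborel. curl (curl_tensor F) x * \<phi> x)"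
    if \<phi>: "\<phi> \<in> test_fun U" for \<phi>
  proof -
    have E': "(E$i$j) (pd k (pd l \<phi>)) = (LINT x|lborel. F x $ i $ j * pd k (pd l \<phi>) x)" for i j k l
      using E test_fun_pd[OF test_fun_pd[OF \<phi>]] by (simp add: given_by_iff)
    have "(LINT x|lborel. v i x * pd k \<phi> x)
      = - (E$i$2) (pd 1 (pd k \<phi>)) + (E$i$1) (pd 2 (pd k \<phi>))" for i k
      unfolding v_def integration_by_parts_curl[OF assms(1) sm sm test_fun_pd[OF \<phi>]] E' ..
    then show ?thesis
      unfolding cc integration_by_parts_curl[OF assms(1) v v \<phi>] Curl_Curl_eq by simp
  qed
  ultimately show ?thesis
    by (simp add: given_by_iff)
qed

lemma classical_incompatibility_iff:
  assumes "open \<Omega>" and E: "\<And>i j. E$i$j \<in> \<A> \<Omega>" and N: "N \<in> \<A> \<Omega>"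
  shows "(\<forall>x\<in>\<Omega> - {0}. curl (curl_tensor (smooth_rep_tensor (\<Omega> - {0}) E)) x = smooth_rep (\<Omega> - {0}) N x)
    \<longleftrightarrow> (\<forall>\<phi>\<in>test_fun (\<Omega> - {0}). Curl (Curl_tensor E) \<phi> = N \<phi>)"
    (is "(\<forall>x\<in>?W. ?c x = ?n x) \<longleftrightarrow> _")
proof -
  have W: "open ?W" using assms(1) by blast
  have "given_by ?W (E$i$j) (\<lambda>x. smooth_rep_tensor ?W E x $ i $ j)" for i j
    using given_by_smooth_rep[OF assms(1) E] by (simp add: smooth_rep_tensor_def)
  from Curl_Curl_given_by[OF W this] have c: "given_by ?W (Curl (Curl_tensor E)) ?c" .
  have n: "given_by ?W N ?n"
    by (rule given_by_smooth_rep[OF assms(1) N])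
  show ?thesis
  proof
    assume "\<forall>x\<in>?W. ?c x = ?n x"
    then have "given_by ?W (Curl (Curl_tensor E)) ?n"
      using given_by_cong[OF W c] by blast
    then show "\<forall>\<phi>\<in>test_fun ?W. Curl (Curl_tensor E) \<phi> = N \<phi>"
      using n by (simp add: given_by_iff)
  next
    assume "\<forall>\<phi>\<in>test_fun ?W. Curl (Curl_tensor E) \<phi> = N \<phi>"
    then have "given_by ?W N ?c"
      using c by (simp add: given_by_iff)
    then show "\<forall>x\<in>?W. ?c x = ?n x"
      using given_by_unique[OF W _ n] by blast
  qed
qed

section \<open>Functionals of finite order\<close>

text \<open>Continuity of order \<open>m\<close> on test functions supported in \<open>K\<close>, phrased through families converging
  to zero instead of seminorms. In this form it passes to sums and, with the order raised by one, to
  distributional derivatives without any computation with seminorms.\<close>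

definition order_at_most :: "nat \<Rightarrow> (real^2) set \<Rightarrow> (real^2) set \<Rightarrow> dist \<Rightarrow> bool" where
  "order_at_most m U K T \<longleftrightarrow> (\<forall>h.
     (\<forall>\<^sub>F \<epsilon> in at_right (0::real). h \<epsilon> \<in> test_fun U \<and> supp (h \<epsilon>) \<subseteq> K) \<longrightarrow>
     (\<forall>is. length is \<le> m \<longrightarrow> (\<forall>e>0. \<forall>\<^sub>F \<epsilon> in at_right 0. \<forall>x. \<bar>foldr pd is (h \<epsilon>) x\<bar> \<le> e)) \<longrightarrow>
     ((\<lambda>\<epsilon>. T (h \<epsilon>)) \<longlongrightarrow> 0) (at_right 0))"

lemma order_at_mostD:
  fixes h :: "real \<Rightarrow> real^2 \<Rightarrow> real"
  assumes "order_at_most m U K T" "\<forall>\<^sub>F \<epsilon> in at_right 0. h \<epsilon> \<in> test_fun U \<and> supp (h \<epsilon>) \<subseteq> K"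
    "\<And>is e. length is \<le> m \<Longrightarrow> e > 0 \<Longrightarrow> \<forall>\<^sub>F \<epsilon> in at_right 0. \<forall>x. \<bar>foldr pd is (h \<epsilon>) x\<bar> \<le> e"
  shows "((\<lambda>\<epsilon>. T (h \<epsilon>)) \<longlongrightarrow> 0) (at_right 0)"
  using assms unfolding order_at_most_def by blast

lemma order_at_most_mono: "order_at_most m U K T \<Longrightarrow> m \<le> n \<Longrightarrow> order_at_most n U K T"
  unfolding order_at_most_def by (meson order_trans)

lemma order_at_most_plus:
  "order_at_most m U K S \<Longrightarrow> order_at_most m U K T \<Longrightarrow> order_at_most m U K (\<lambda>\<phi>. S \<phi> + T \<phi>)"
  unfolding order_at_most_def by (auto intro!: tendsto_add_zero)

lemma order_at_most_minus:
  assumes "order_at_most m U K S" "order_at_most m U K T"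
  shows "order_at_most m U K (\<lambda>\<phi>. S \<phi> - T \<phi>)"
  unfolding order_at_most_def
proof (intro allI impI)
  fix h :: "real \<Rightarrow> real^2 \<Rightarrow> real"
  assume "\<forall>\<^sub>F \<epsilon> in at_right 0. h \<epsilon> \<in> test_fun U \<and> supp (h \<epsilon>) \<subseteq> K"
    "\<forall>is. length is \<le> m \<longrightarrow> (\<forall>e>0. \<forall>\<^sub>F \<epsilon> in at_right 0. \<forall>x. \<bar>foldr pd is (h \<epsilon>) x\<bar> \<le> e)"
  then have "((\<lambda>\<epsilon>. S (h \<epsilon>)) \<longlongrightarrow> 0) (at_right 0)" "((\<lambda>\<epsilon>. T (h \<epsilon>)) \<longlongrightarrow> 0) (at_right 0)"
    using assms unfolding order_at_most_def by blast+
  from tendsto_diff[OF this] show "((\<lambda>\<epsilon>. S (h \<epsilon>) - T (h \<epsilon>)) \<longlongrightarrow> 0) (at_right 0)" by simp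
qed

lemma order_at_most_pd:
  assumes "order_at_most m U K T"
  shows "order_at_most (Suc m) U K (\<lambda>\<phi>. T (pd i \<phi>))"
  unfolding order_at_most_def
proof (intro allI impI)
  fix h :: "real \<Rightarrow> real^2 \<Rightarrow> real"
  assume h: "\<forall>\<^sub>F \<epsilon> in at_right 0. h \<epsilon> \<in> test_fun U \<and> supp (h \<epsilon>) \<subseteq> K"
    and small: "\<forall>is. length is \<le> Suc m \<longrightarrow> (\<forall>e>0. \<forall>\<^sub>F \<epsilon> in at_right 0. \<forall>x. \<bar>foldr pd is (h \<epsilon>) x\<bar> \<le> e)"
  show "((\<lambda>\<epsilon>. T (pd i (h \<epsilon>))) \<longlongrightarrow> 0) (at_right 0)"
  proof (rule order_at_mostD[OF assms])
    show "\<forall>\<^sub>F \<epsilon> in at_right 0. pd i (h \<epsilon>) \<in> test_fun U \<and> supp (pd i (h \<epsilon>)) \<subseteq> K"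
      using h by (rule eventually_mono) (use supp_pd_subset in \<open>auto intro: test_fun_pd subset_trans\<close>)
  next
    fix "is" :: "2 list" and e :: real assume "length is \<le> m" "e > 0"
    then show "\<forall>\<^sub>F \<epsilon> in at_right 0. \<forall>x. \<bar>foldr pd is (pd i (h \<epsilon>)) x\<bar> \<le> e"
      using small[rule_format, of "is @ [i]" e] by simp
  qed
qed

lemma finite_mi_abs_le: "finite {\<alpha>. mi_abs \<alpha> \<le> m}"
  by (rule finite_subset[of _ "{..m} \<times> {..m}"]) (auto simp: mi_abs_def)

lemma distribution_order_at_most:
  assumes "distribution_on U T" "compact K" "K \<subseteq> U"
  obtains m where "order_at_most m U K T"
proof -
  obtain C m where bound: "\<And>\<phi>. \<phi> \<in> test_fun U \<Longrightarrow> supp \<phi> \<subseteq> K \<Longrightarrow>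
      \<bar>T \<phi>\<bar> \<le> C * (\<Sum>\<alpha> | mi_abs \<alpha> \<le> m. SUP x. \<bar>mpd \<alpha> \<phi> x\<bar>)"
    using assms(1)[unfolded distribution_on_def, THEN conjunct2, THEN conjunct2, rule_format,
        OF conjI, OF assms(2,3)] by auto
  let ?A = "{\<alpha>. mi_abs \<alpha> \<le> m}"
  have "order_at_most m U K T"
    unfolding order_at_most_def
  proof (intro allI impI)
    fix h :: "real \<Rightarrow> real^2 \<Rightarrow> real"
    assume h: "\<forall>\<^sub>F \<epsilon> in at_right 0. h \<epsilon> \<in> test_fun U \<and> supp (h \<epsilon>) \<subseteq> K"
      and small: "\<forall>is. length is \<le> m \<longrightarrow> (\<forall>e>0. \<forall>\<^sub>F \<epsilon> in at_right 0. \<forall>x. \<bar>foldr pd is (h \<epsilon>) x\<bar> \<le> e)"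
    show "((\<lambda>\<epsilon>. T (h \<epsilon>)) \<longlongrightarrow> 0) (at_right 0)"
    proof (rule tendstoI)
      fix d :: real assume "d > 0"
      \<comment> \<open>the summand \<open>1\<close> keeps the denominator positive when \<open>C = 0\<close>\<close>
      define e where "e = d / (\<bar>C\<bar> * card ?A + 1)"
      have den: "\<bar>C\<bar> * card ?A + 1 > 0"
        by (simp add: add_nonneg_pos)
      have e: "e > 0" "\<bar>C\<bar> * (card ?A * e) < d"
        using \<open>d > 0\<close> den by (auto simp: e_def field_simps)
      have "\<forall>\<^sub>F \<epsilon> in at_right 0. \<forall>\<alpha>\<in>?A. \<forall>x. \<bar>mpd \<alpha> (h \<epsilon>) x\<bar> \<le> e"
        by (rule eventually_ball_finite[OF finite_mi_abs_le])
          (use small e in \<open>auto simp: mpd_eq_foldr mi_abs_def simp del: foldr_append\<close>)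
      with h show "\<forall>\<^sub>F \<epsilon> in at_right 0. dist (T (h \<epsilon>)) 0 < d"
      proof eventually_elim
        case (elim \<epsilon>)
        have "\<bar>SUP x. \<bar>mpd \<alpha> (h \<epsilon>) x\<bar>\<bar> \<le> e" if "\<alpha> \<in> ?A" for \<alpha>
        proof -
          have "\<bar>mpd \<alpha> (h \<epsilon>) x\<bar> \<le> e" for x
            using elim that by blast
          then show ?thesis
            by (intro cSup_abs_le) auto
        qed
        then have "\<bar>\<Sum>\<alpha>\<in>?A. SUP x. \<bar>mpd \<alpha> (h \<epsilon>) x\<bar>\<bar> \<le> (\<Sum>\<alpha>\<in>?A. e)"
          by (intro order_trans[OF sum_abs] sum_mono) auto
        then have "\<bar>C\<bar> * \<bar>\<Sum>\<alpha>\<in>?A. SUP x. \<bar>mpd \<alpha> (h \<epsilon>) x\<bar>\<bar> \<le> \<bar>C\<bar> * (card ?A * e)"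
          by (intro mult_left_mono) auto
        moreover have "\<bar>T (h \<epsilon>)\<bar> \<le> \<bar>C\<bar> * \<bar>\<Sum>\<alpha>\<in>?A. SUP x. \<bar>mpd \<alpha> (h \<epsilon>) x\<bar>\<bar>"
          using bound[of "h \<epsilon>"] elim unfolding abs_mult[symmetric] by (meson abs_ge_self order_trans)
        ultimately show ?case
          using e by simp
      qed
    qed
  qed
  then show ?thesis by (rule that)
qed

section \<open>Functionals vanishing off the origin\<close>

text \<open>The family \<open>h\<close> is at most of the order of \<open>\<epsilon> powi p\<close> on the ball of radius \<open>\<epsilon>\<close>, the place where the
  rescaled cutoffs live. In the recursion below every derivative may cost one power of \<open>\<epsilon>\<close>, as
  for a function of \<open>x / \<epsilon>\<close>.\<close>

definition scaled_bound :: "int \<Rightarrow> (real \<Rightarrow> real^2 \<Rightarrow> real) \<Rightarrow> bool" where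
  "scaled_bound p h \<longleftrightarrow> (\<exists>C. \<forall>\<epsilon>\<in>{0<..<1}. \<forall>x\<in>ball 0 \<epsilon>. \<bar>h \<epsilon> x\<bar> \<le> C * \<epsilon> powi p)"

primrec decay :: "nat \<Rightarrow> int \<Rightarrow> (real \<Rightarrow> real^2 \<Rightarrow> real) \<Rightarrow> bool" where
  "decay 0 p h \<longleftrightarrow> scaled_bound p h"
| "decay (Suc n) p h \<longleftrightarrow> scaled_bound p h \<and> (\<forall>i. decay n (p - 1) (\<lambda>\<epsilon>. pd i (h \<epsilon>)))"

lemma scaled_boundI:
  assumes "\<And>\<epsilon> x. \<epsilon> \<in> {0<..<1} \<Longrightarrow> x \<in> ball 0 \<epsilon> \<Longrightarrow> \<bar>h \<epsilon> x\<bar> \<le> C * \<epsilon> powi p"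
  shows "scaled_bound p h"
  unfolding scaled_bound_def by (intro exI[of _ C] ballI assms)

lemma decay_scaled_bound: "decay n p h \<Longrightarrow> scaled_bound p h"
  by (cases n) auto

lemma decay_foldr_pd:
  "decay n p h \<Longrightarrow> length is \<le> n \<Longrightarrow> scaled_bound (p - int (length is)) (\<lambda>\<epsilon>. foldr pd is (h \<epsilon>))"
proof (induction "is" arbitrary: n p h rule: rev_induct)
  case Nil
  then show ?case using decay_scaled_bound[of n p h] by simp
next
  case (snoc i "is")
  then obtain n' where n: "n = Suc n'" by (cases n) auto
  then have "decay n' (p - 1) (\<lambda>\<epsilon>. pd i (h \<epsilon>))" "length is \<le> n'"
    using snoc.prems by auto
  from snoc.IH[OF this] show ?case
    by (simp add: algebra_simps)
qed

lemma decay_decrease: "decay (Suc n) p h \<Longrightarrow> decay n p h"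
proof (induction n arbitrary: p h)
  case (Suc n)
  then show ?case by (metis decay.simps(2))
qed simp

lemma scaled_bound_add:
  assumes "scaled_bound p h" "scaled_bound p k"
  shows "scaled_bound p (\<lambda>\<epsilon> x. h \<epsilon> x + k \<epsilon> x)"
proof -
  obtain C where C: "\<And>\<epsilon> x. \<epsilon> \<in> {0<..<1} \<Longrightarrow> x \<in> ball 0 \<epsilon> \<Longrightarrow> \<bar>h \<epsilon> x\<bar> \<le> C * \<epsilon> powi p"
    using assms(1) unfolding scaled_bound_def by blast
  obtain D where D: "\<And>\<epsilon> x. \<epsilon> \<in> {0<..<1} \<Longrightarrow> x \<in> ball 0 \<epsilon> \<Longrightarrow> \<bar>k \<epsilon> x\<bar> \<le> D * \<epsilon> powi p"
    using assms(2) unfolding scaled_bound_def by blast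
  show ?thesis
    by (rule scaled_boundI[of _ "C + D"], unfold distrib_right)
      (intro order_trans[OF abs_triangle_ineq] add_mono C D)
qed

lemma scaled_bound_mult:
  assumes "scaled_bound p h" "scaled_bound q k"
  shows "scaled_bound (p + q) (\<lambda>\<epsilon> x. h \<epsilon> x * k \<epsilon> x)"
proof -
  obtain C where C: "\<And>\<epsilon> x. \<epsilon> \<in> {0<..<1} \<Longrightarrow> x \<in> ball 0 \<epsilon> \<Longrightarrow> \<bar>h \<epsilon> x\<bar> \<le> C * \<epsilon> powi p"
    using assms(1) unfolding scaled_bound_def by blast
  obtain D where D: "\<And>\<epsilon> x. \<epsilon> \<in> {0<..<1} \<Longrightarrow> x \<in> ball 0 \<epsilon> \<Longrightarrow> \<bar>k \<epsilon> x\<bar> \<le> D * \<epsilon> powi q"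
    using assms(2) unfolding scaled_bound_def by blast
  show ?thesis
  proof (rule scaled_boundI[of _ "C * D"])
    fix \<epsilon> :: real and x :: "real^2" assume *: "\<epsilon> \<in> {0<..<1}" "x \<in> ball 0 \<epsilon>"
    have "\<bar>h \<epsilon> x\<bar> * \<bar>k \<epsilon> x\<bar> \<le> (C * \<epsilon> powi p) * (D * \<epsilon> powi q)"
      by (intro mult_mono C D * order_trans[OF abs_ge_zero C[OF *]]) simp
    then show "\<bar>h \<epsilon> x * k \<epsilon> x\<bar> \<le> C * D * \<epsilon> powi (p + q)"
      using * by (simp add: abs_mult power_int_add mult_ac)
  qed
qed

lemma decay_add:
  assumes "\<And>\<epsilon>. smooth_on UNIV (h \<epsilon>)" "\<And>\<epsilon>. smooth_on UNIV (k \<epsilon>)" "decay n p h" "decay n p k"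
  shows "decay n p (\<lambda>\<epsilon> x. h \<epsilon> x + k \<epsilon> x)"
  using assms
proof (induction n arbitrary: p h k)
  case (Suc n)
  have "decay n (p - 1) (\<lambda>\<epsilon>. pd i (\<lambda>x. h \<epsilon> x + k \<epsilon> x))" for i
    unfolding smooth_pd_add[OF Suc.prems(1,2)]
    by (rule Suc.IH) (use Suc.prems in \<open>auto intro: smooth_on_pd\<close>)
  then show ?case
    using Suc.prems by (simp add: scaled_bound_add)
qed (simp add: scaled_bound_add)

text \<open>The product rule is the reason for tracking exponents: both of its terms have
  exponent \<open>p + q - 1\<close>, one less than the product, so the induction on the order closes up.\<close>

lemma decay_mult:
  assumes "\<And>\<epsilon>. smooth_on UNIV (h \<epsilon>)" "\<And>\<epsilon>. smooth_on UNIV (k \<epsilon>)" "decay n p h" "decay n q k"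
  shows "decay n (p + q) (\<lambda>\<epsilon> x. h \<epsilon> x * k \<epsilon> x)"
  using assms
proof (induction n arbitrary: p q h k)
  case (Suc n)
  have pd: "decay n (p - 1) (\<lambda>\<epsilon>. pd i (h \<epsilon>))" "decay n (q - 1) (\<lambda>\<epsilon>. pd i (k \<epsilon>))" for i
    using Suc.prems by auto
  have "decay n (p + q - 1) (\<lambda>\<epsilon>. pd i (\<lambda>x. h \<epsilon> x * k \<epsilon> x))" for i
  proof -
    have "decay n (p + (q - 1)) (\<lambda>\<epsilon> x. h \<epsilon> x * pd i (k \<epsilon>) x)"
      by (intro Suc.IH pd smooth_on_pd Suc.prems(1,2) decay_decrease[OF Suc.prems(3)])
    moreover have "decay n ((p - 1) + q) (\<lambda>\<epsilon> x. pd i (h \<epsilon>) x * k \<epsilon> x)"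
      by (intro Suc.IH pd smooth_on_pd Suc.prems(1,2) decay_decrease[OF Suc.prems(4)])
    moreover have "p + (q - 1) = p + q - 1" "(p - 1) + q = p + q - 1" by auto
    ultimately show ?thesis
      unfolding smooth_pd_mult[OF Suc.prems(1,2)]
      by (intro decay_add smooth_on_mult smooth_on_pd Suc.prems(1,2) open_UNIV) simp_all
  qed
  then show ?case
    using Suc.prems by (simp add: scaled_bound_mult)
qed (simp add: scaled_bound_mult)

lemma decay_scaled:
  fixes g :: "real^2 \<Rightarrow> real"
  assumes "g \<in> test_fun U" "\<And>\<epsilon>. \<epsilon> \<in> {0<..<1} \<Longrightarrow> h \<epsilon> = (\<lambda>x. \<epsilon> powi p * g ((1 / \<epsilon>) *\<^sub>R x))"
  shows "decay n p h"
  using assms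
proof (induction n arbitrary: p g h)
  case 0
  obtain M where "\<And>x. \<bar>g x\<bar> \<le> M"
    using test_fun_bounded[OF 0(1)] by metis
  then show ?case
    by (auto intro!: scaled_boundI[of _ M] simp: 0 abs_mult mult.commute mult_right_mono)
next
  case (Suc n)
  obtain M where "\<And>x. \<bar>g x\<bar> \<le> M"
    using test_fun_bounded[OF Suc.prems(1)] by metis
  then have "scaled_bound p h"
    by (auto intro!: scaled_boundI[of _ M] simp: Suc.prems abs_mult mult.commute mult_right_mono)
  moreover have "decay n (p - 1) (\<lambda>\<epsilon>. pd i (h \<epsilon>))" for i
  proof (rule Suc.IH[OF test_fun_pd[OF Suc.prems(1)]])
    fix \<epsilon> :: real assume \<epsilon>: "\<epsilon> \<in> {0<..<1}"
    have sm: "smooth_on UNIV g" by (rule test_funD(1)[OF Suc.prems(1)])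
    have "pd i (h \<epsilon>) = (\<lambda>x. \<epsilon> powi p * ((1 / \<epsilon>) *\<^sub>R pd i g ((1 / \<epsilon>) *\<^sub>R x)))"
      unfolding Suc.prems(2)[OF \<epsilon>]
      using smooth_on_differentiable[OF sm] smooth_on_scaled_argument[OF sm]
      by (simp add: smooth_pd_cmult pd_scaled_argument)
    then show "pd i (h \<epsilon>) = (\<lambda>x. \<epsilon> powi (p - 1) * pd i g ((1 / \<epsilon>) *\<^sub>R x))"
      using \<epsilon> by (simp add: power_int_diff)
  qed
  ultimately show ?case by auto
qed

text \<open>The factor \<open>2\<close> bounds the norm of the gradient by its largest component.\<close>

lemma bound_by_gradient:
  fixes g :: "real^2 \<Rightarrow> real"
  assumes "smooth_on UNIV g" "g 0 = 0" "\<And>i x. x \<in> ball 0 \<epsilon> \<Longrightarrow> \<bar>pd i g x\<bar> \<le> B" "x \<in> ball 0 \<epsilon>" "B \<ge> 0"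
  shows "\<bar>g x\<bar> \<le> 2 * B * \<epsilon>"
proof -
  have diff: "g differentiable (at y)" for y
    using assms(1) by (rule smooth_on_differentiable) simp
  have on: "onorm (frechet_derivative g (at y)) \<le> 2 * B" if "y \<in> ball 0 \<epsilon>" for y
  proof (rule onorm_le)
    fix v :: "real^2"
    have lin: "linear (frechet_derivative g (at y))"
      by (rule linear_frechet_derivative[OF diff])
    have "v = v$1 *\<^sub>R axis 1 1 + v$2 *\<^sub>R axis 2 1"
      by (simp add: vec_eq_iff forall_2 axis_def)
    then have "frechet_derivative g (at y) v = v$1 * pd 1 g y + v$2 * pd 2 g y"
      using linear_add[OF lin] linear_cmul[OF lin] unfolding pd_def by (metis real_scaleR_def)
    also have "\<bar>\<dots>\<bar> \<le> norm v * B + norm v * B"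
      by (intro order_trans[OF abs_triangle_ineq] add_mono)
        (auto simp: abs_mult intro!: mult_mono component_le_norm_cart assms(3) that)
    finally show "norm (frechet_derivative g (at y) v) \<le> 2 * B * norm v"
      by (simp add: mult_ac)
  qed
  have "0 \<in> ball (0::real^2) \<epsilon>"
    using assms(4) by (auto intro: le_less_trans[OF norm_ge_zero])
  from differentiable_bound[OF convex_ball has_derivative_at_withinI[OF has_derivative_frechet[OF diff]]
      on assms(4) this]
  have "\<bar>g x\<bar> \<le> 2 * B * norm x"
    using assms(2) by simp
  also have "\<dots> \<le> 2 * B * \<epsilon>"
    using assms(4,5) by (intro mult_left_mono) auto
  finally show ?thesis .
qed

text \<open>Taylor: every order of differentiation that vanishes at the origin gains one power of \<open>\<epsilon>\<close>, by the mean
  value inequality.\<close>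

lemma decay_vanishing:
  fixes g :: "real^2 \<Rightarrow> real"
  assumes "g \<in> test_fun U" "\<And>is. length is \<le> n \<Longrightarrow> foldr pd is g 0 = 0"
  shows "decay n (int n + 1) (\<lambda>\<epsilon>. g)"
  using assms
proof (induction n arbitrary: g)
  case 0
  obtain M1 M2 where "\<And>x. \<bar>pd 1 g x\<bar> \<le> M1" "\<And>x. \<bar>pd 2 g x\<bar> \<le> M2"
    using test_fun_bounded[OF test_fun_pd[OF 0(1)]] by metis
  then have M: "\<bar>pd i g x\<bar> \<le> max M1 M2" for i x
    using exhaust_2[of i] by (metis max.coboundedI1 max.coboundedI2)
  have "\<bar>g x\<bar> \<le> 2 * max M1 M2 * \<epsilon>" if "\<epsilon> \<in> {0<..<1}" "x \<in> ball 0 \<epsilon>" for \<epsilon> x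
    by (rule bound_by_gradient) (use 0(2)[of "[]"] test_funD(1)[OF 0(1)] M that order_trans[OF abs_ge_zero M] in auto)
  then show ?case by (auto intro: scaled_boundI[of _ "2 * max M1 M2"])
next
  case (Suc n)
  have d: "decay n (int n + 1) (\<lambda>\<epsilon>. pd i g)" for i
  proof (rule Suc.IH[OF test_fun_pd[OF Suc.prems(1)]])
    fix "is" :: "2 list" assume "length is \<le> n"
    then show "foldr pd is (pd i g) 0 = 0"
      using Suc.prems(2)[of "is @ [i]"] by simp
  qed
  have "\<exists>C. \<forall>\<epsilon>\<in>{0<..<1}. \<forall>x\<in>ball 0 \<epsilon>. \<bar>pd i g x\<bar> \<le> C * \<epsilon> powi (int n + 1)" for i
    using decay_scaled_bound[OF d] by (simp add: scaled_bound_def)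
  then obtain C where C: "\<And>i \<epsilon> x. \<epsilon> \<in> {0<..<1} \<Longrightarrow> x \<in> ball 0 \<epsilon> \<Longrightarrow> \<bar>pd i g x\<bar> \<le> C i * \<epsilon> powi (int n + 1)"
    by metis
  define B where "B = max \<bar>C 1\<bar> \<bar>C 2\<bar>"
  have B: "\<bar>pd i g x\<bar> \<le> B * \<epsilon> powi (int n + 1)" if "\<epsilon> \<in> {0<..<1}" "x \<in> ball 0 \<epsilon>" for i \<epsilon> x
  proof -
    have "C i \<le> B"
      using exhaust_2[of i] by (auto simp: B_def)
    then show ?thesis
      using C[OF that, of i] that by (meson greaterThanLessThan_iff mult_right_mono order.trans zero_le_power_int less_imp_le)
  qed
  have "scaled_bound (int (Suc n) + 1) (\<lambda>\<epsilon>. g)"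
  proof (rule scaled_boundI[of _ "2 * B"])
    fix \<epsilon> :: real and x :: "real^2" assume that: "\<epsilon> \<in> {0<..<1}" "x \<in> ball 0 \<epsilon>"
    have "\<bar>g x\<bar> \<le> 2 * (B * \<epsilon> powi (int n + 1)) * \<epsilon>"
    proof (rule bound_by_gradient)
      show "0 \<le> B * \<epsilon> powi (int n + 1)"
        using that by (auto simp: B_def intro!: mult_nonneg_nonneg)
    qed (use Suc.prems(2)[of "[]"] test_funD(1)[OF Suc.prems(1)] B[OF that(1)] that in auto)
    also have "\<dots> = (2 * B) * \<epsilon> powi (int (Suc n) + 1)"
      using that power_int_add_1[of \<epsilon> "int n + 1"] by (simp add: add_ac)
    finally show "\<bar>g x\<bar> \<le> 2 * B * \<epsilon> powi (int (Suc n) + 1)" .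
  qed
  with d show ?case by (simp add: add.commute)
qed

text \<open>With a cutoff \<open>\<eta>\<close>, the functional does not distinguish \<open>g\<close> from
  \<open>h \<epsilon> = \<eta> (x / \<epsilon>) g\<close>, since their difference is supported away from the origin. The derivatives
  of \<open>h \<epsilon>\<close> of order \<open>j \<le> m\<close> are of size \<open>\<epsilon> ^ (m + 1 - j)\<close>, so \<open>T (h \<epsilon>)\<close>, which is constant
  in \<open>\<epsilon>\<close>, tends to zero.\<close>

lemma eq_0_if_vanishing_at_origin:
  assumes lin: "linear_on_tests U T" and away: "\<And>\<phi>. \<phi> \<in> test_fun (U - {0}) \<Longrightarrow> T \<phi> = 0"
    and ord: "order_at_most m U (cball 0 \<rho>) T" and \<rho>: "\<rho> > 0"
    and g: "g \<in> test_fun U" "\<And>is. length is \<le> m \<Longrightarrow> foldr pd is g 0 = 0"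
  shows "T g = 0"
proof -
  obtain \<eta> :: "real^2 \<Rightarrow> real" where \<eta>: "smooth_on UNIV \<eta>" "\<And>y. 0 \<le> \<eta> y"
    "\<And>y. dist 0 y \<le> 1/4 \<Longrightarrow> \<eta> y = 1" "\<And>y. 1/2 \<le> dist 0 y \<Longrightarrow> \<eta> y = 0"
    using exists_cutoff[of "1/4" "1/2" 0] by auto
  have \<eta>_test: "\<eta> \<in> test_fun UNIV"
    by (rule test_funI[of _ "cball 0 (1/2)"]) (use \<eta> in auto)
  define k where "k \<epsilon> x = \<eta> ((1 / \<epsilon>) *\<^sub>R x)" for \<epsilon> :: real and x
  define h where "h \<epsilon> x = k \<epsilon> x * g x" for \<epsilon> x
  have ksm: "smooth_on UNIV (k \<epsilon>)" for \<epsilon>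
    unfolding k_def by (rule smooth_on_scaled_argument[OF \<eta>(1)])
  have htest: "h \<epsilon> \<in> test_fun U" for \<epsilon>
    unfolding h_def by (rule test_fun_smooth_mult[OF open_UNIV ksm g(1)]) simp
  have hsupp: "supp (h \<epsilon>) \<subseteq> cball 0 (\<epsilon>/2)" if "\<epsilon> > 0" for \<epsilon>
    by (rule supp_subset_closed) (use that \<eta>(4) in \<open>auto simp: h_def k_def field_simps\<close>)
  have "decay m (0 + (int m + 1)) h"
    unfolding h_def
  proof (rule decay_mult[OF ksm])
    show "decay m 0 k"
      by (rule decay_scaled[OF \<eta>_test]) (simp add: k_def fun_eq_iff)
  qed (use test_funD(1)[OF g(1)] decay_vanishing[OF g] in auto)
  then have dec: "decay m (int m + 1) h" by simp
  have ev1: "\<forall>\<^sub>F \<epsilon> in at_right 0. \<epsilon> \<in> {0<..<min c 1}" if "c > 0" for c :: real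
    using eventually_at_right_real[of 0 "min c 1"] that by simp
  have "((\<lambda>\<epsilon>. T (h \<epsilon>)) \<longlongrightarrow> 0) (at_right 0)"
  proof (rule order_at_mostD[OF ord])
    show "\<forall>\<^sub>F \<epsilon> in at_right 0. h \<epsilon> \<in> test_fun U \<and> supp (h \<epsilon>) \<subseteq> cball 0 \<rho>"
      using ev1[OF \<rho>] by (rule eventually_mono) (use htest hsupp in \<open>force\<close>)
  next
    fix "is" :: "2 list" and e :: real assume len: "length is \<le> m" and e: "e > 0"
    obtain C where C: "\<And>\<epsilon> x. \<epsilon> \<in> {0<..<1} \<Longrightarrow> x \<in> ball 0 \<epsilon> \<Longrightarrow>
        \<bar>foldr pd is (h \<epsilon>) x\<bar> \<le> C * \<epsilon> powi (int m + 1 - int (length is))"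
      using decay_foldr_pd[OF dec len] unfolding scaled_bound_def by blast
    have "\<forall>\<^sub>F \<epsilon> in at_right 0. \<epsilon> \<in> {0<..<min (e / (\<bar>C\<bar> + 1)) 1}"
      by (rule ev1) (use e in \<open>auto simp: add_nonneg_pos\<close>)
    then show "\<forall>\<^sub>F \<epsilon> in at_right 0. \<forall>x. \<bar>foldr pd is (h \<epsilon>) x\<bar> \<le> e"
    proof eventually_elim
      case (elim \<epsilon>)
      then have \<epsilon>: "0 < \<epsilon>" "\<epsilon> < 1" "\<epsilon> * (\<bar>C\<bar> + 1) < e"
        by (auto simp: field_simps)
      show ?case
      proof
        fix x
        show "\<bar>foldr pd is (h \<epsilon>) x\<bar> \<le> e"
        proof (cases "x \<in> ball 0 \<epsilon>")
          case True
          have "\<epsilon> powi (int m + 1 - int (length is)) = \<epsilon> ^ (Suc (m - length is))"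
            using len by (simp add: power_int_def nat_diff_distrib' of_nat_diff Suc_diff_le nat_add_distrib)
          also have "\<dots> \<le> \<epsilon>"
            using \<epsilon> by (simp add: mult_left_le power_le_one)
          finally have "\<bar>C\<bar> * \<epsilon> powi (int m + 1 - int (length is)) \<le> \<bar>C\<bar> * \<epsilon>"
            by (intro mult_left_mono) auto
          moreover have "C * \<epsilon> powi (int m + 1 - int (length is)) \<le> \<bar>C\<bar> * \<epsilon> powi (int m + 1 - int (length is))"
            using \<epsilon> by (intro mult_right_mono) auto
          moreover have "\<bar>C\<bar> * \<epsilon> \<le> \<epsilon> * (\<bar>C\<bar> + 1)"
            using \<epsilon> by (simp add: algebra_simps)
          moreover have "\<bar>foldr pd is (h \<epsilon>) x\<bar> \<le> C * \<epsilon> powi (int m + 1 - int (length is))"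
            by (rule C) (use True \<epsilon> in auto)
          ultimately show ?thesis
            using \<epsilon>(3) by linarith
        next
          case False
          then have "x \<notin> supp (h \<epsilon>)"
            using hsupp[OF \<epsilon>(1)] \<epsilon> by auto
          then have "foldr pd is (h \<epsilon>) x = 0"
            using supp_foldr_pd_subset[of "is" "h \<epsilon>"] by (intro zero_outside_supp) auto
          then show ?thesis using e by simp
        qed
      qed
    qed
  qed
  moreover have "\<forall>\<^sub>F \<epsilon> in at_right 0. T (h \<epsilon>) = T g"
    using eventually_at_right_less[of 0]
  proof eventually_elim
    case (elim \<epsilon>)
    have "(\<lambda>x. g x - h \<epsilon> x) \<in> test_fun (U - {0})"
    proof (rule test_funI[of _ "supp g - ball 0 (\<epsilon>/4)"])
      show "smooth_on UNIV (\<lambda>x. g x - h \<epsilon> x)"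
        by (intro smooth_on_diff test_funD(1)[OF g(1)] test_funD(1)[OF htest] open_UNIV)
      show "compact (supp g - ball 0 (\<epsilon>/4))"
        by (intro compact_diff test_funD(2)[OF g(1)] open_ball)
      show "supp g - ball 0 (\<epsilon>/4) \<subseteq> U - {0}"
        using test_funD(3)[OF g(1)] elim by auto
      show "g x - h \<epsilon> x = 0" if "x \<notin> supp g - ball 0 (\<epsilon>/4)" for x
      proof (cases "x \<in> supp g")
        case True
        then have "k \<epsilon> x = 1"
          unfolding k_def using that elim by (intro \<eta>(3)) (auto simp: field_simps)
        then show ?thesis by (simp add: h_def)
      qed (simp add: h_def zero_outside_supp)
    qed
    from away[OF this] show ?case
      by (simp add: linear_on_tests_diff[OF lin g(1) htest])
  qed
  ultimately have "((\<lambda>\<epsilon>. T g) \<longlongrightarrow> 0) (at_right (0::real))"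
    by (rule Lim_transform_eventually)
  then show ?thesis
    by (simp add: tendsto_const_iff)
qed

section \<open>Expansion in derivatives of the Dirac distribution\<close>

lemma foldr_pd_cmult:
  fixes f :: "real^2 \<Rightarrow> real"
  assumes "smooth_on UNIV f"
  shows "foldr pd is (\<lambda>x. c * f x) = (\<lambda>x. c * foldr pd is f x)"
  by (induction "is") (simp_all add: smooth_pd_cmult smooth_on_foldr_pd[OF assms])

lemma foldr_pd_add:
  assumes "smooth_on UNIV f" "smooth_on UNIV g"
  shows "foldr pd is (\<lambda>x. f x + g x) = (\<lambda>x. foldr pd is f x + foldr pd is g x)"
  by (induction "is") (simp_all add: smooth_pd_add smooth_on_foldr_pd assms)

lemma foldr_pd_zero: "foldr pd is (\<lambda>x. 0) = (\<lambda>x. 0)"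
  by (induction "is") simp_all

lemma foldr_pd_sum:
  fixes f :: "'a \<Rightarrow> real^2 \<Rightarrow> real"
  assumes "\<And>a. a \<in> A \<Longrightarrow> smooth_on UNIV (f a)"
  shows "foldr pd is (\<lambda>x. \<Sum>a\<in>A. c a * f a x) = (\<lambda>x. \<Sum>a\<in>A. c a * foldr pd is (f a) x)"
  using assms
proof (induction A rule: infinite_finite_induct)
  case (insert a A)
  then show ?case
    by (simp add: foldr_pd_add foldr_pd_cmult smooth_on_cmult smooth_on_sum)
qed (simp_all add: foldr_pd_zero)

text \<open>The right-hand side is \<open>T\<close> applied to a combination of the \<open>w \<alpha>\<close> with the same derivatives as
  \<open>\<phi>\<close> at the origin up to order \<open>m\<close>. This expresses \<open>T\<close> as a combination of derivatives of the
  Dirac distribution with coefficients \<open>T (w \<alpha>)\<close>.\<close>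

lemma expansion_at_origin:
  assumes lin: "linear_on_tests U T" and away: "\<And>\<phi>. \<phi> \<in> test_fun (U - {0}) \<Longrightarrow> T \<phi> = 0"
    and ord: "order_at_most m U (cball 0 \<rho>) T" and \<rho>: "\<rho> > 0"
    and w: "\<And>\<alpha>. w \<alpha> \<in> test_fun U"
      "\<And>\<alpha> \<beta>. mpd \<beta> (w \<alpha>) 0 = (if \<beta> = \<alpha> then (-1) ^ mi_abs \<alpha> else 0)"
    and \<phi>: "\<phi> \<in> test_fun U"
  shows "T \<phi> = (\<Sum>\<alpha> | mi_abs \<alpha> \<le> m. ((-1) ^ mi_abs \<alpha> * mpd \<alpha> \<phi> 0) * T (w \<alpha>))"
proof -
  let ?A = "{\<alpha>. mi_abs \<alpha> \<le> m}"
  let ?c = "\<lambda>\<alpha>. (-1) ^ mi_abs \<alpha> * mpd \<alpha> \<phi> 0 :: real"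
  let ?s = "\<lambda>x. \<Sum>\<alpha>\<in>?A. ?c \<alpha> * w \<alpha> x"
  have s: "?s \<in> test_fun U"
    by (intro test_fun_sum test_fun_cmult w)
  let ?g = "\<lambda>x. \<phi> x + (-1) * ?s x"
  have g: "?g \<in> test_fun U"
    by (intro test_fun_add test_fun_cmult s \<phi>)
  have "T ?g = 0"
  proof (rule eq_0_if_vanishing_at_origin[OF lin away ord \<rho> g])
    fix "is" :: "2 list" assume "length is \<le> m"
    define \<beta> where "\<beta> = (count_list is 1, count_list is 2)"
    have \<beta>: "\<beta> \<in> ?A"
      using \<open>length is \<le> m\<close> by (simp add: \<beta>_def mi_abs_def length_eq_count_2)
    have mpd: "foldr pd is f = mpd \<beta> f" if "smooth_on UNIV f" for f :: "real^2 \<Rightarrow> real"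
      unfolding \<beta>_def by (rule foldr_pd_eq_mpd[OF that])
    have "foldr pd is ?g 0 = foldr pd is \<phi> 0 - (\<Sum>\<alpha>\<in>?A. ?c \<alpha> * foldr pd is (w \<alpha>) 0)"
      using test_funD(1)[OF \<phi>] test_funD(1)[OF w(1)] test_funD(1)[OF s]
      by (simp only: foldr_pd_add foldr_pd_cmult foldr_pd_sum smooth_on_cmult open_UNIV)
    also have "\<dots> = mpd \<beta> \<phi> 0 - (\<Sum>\<alpha>\<in>?A. if \<beta> = \<alpha> then ?c \<alpha> * (-1) ^ mi_abs \<alpha> else 0)"
      using test_funD(1)[OF \<phi>] test_funD(1)[OF w(1)] by (simp add: mpd w(2) if_distrib cong: if_cong)
    also have "\<dots> = 0"
      using \<beta> finite_mi_abs_le[of m] by (simp add: sum.delta flip: power_add mult_2)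
    finally show "foldr pd is ?g 0 = 0" .
  qed simp
  moreover have "T ?g = T \<phi> + (-1) * T ?s"
    using linear_on_tests_add[OF lin \<phi> test_fun_cmult[OF s, of "-1"]] linear_on_tests_cmult[OF lin s, of "-1"] by simp
  ultimately show ?thesis
    using linear_on_tests_sum[OF lin, of ?A w ?c] w(1) by simp
qed

section \<open>Scaling\<close>

text \<open>The set whose infimum is the scaling degree. It is closed upwards, so exponents found
  for \<open>Curl Curl E\<close> and for \<open>N\<close> have a common one for their difference.\<close>

definition scaling_exponents :: "real \<Rightarrow> ((real^2 \<Rightarrow> 'b::real_normed_vector) \<Rightarrow> real) \<Rightarrow> real set" where
  "scaling_exponents r T =
     {k. \<forall>\<phi>\<in>test_fun (ball 0 r). ((\<lambda>l. l powr k * T (rescale l \<phi>)) \<longlongrightarrow> 0) (at_right 0)}"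

lemma scaling_degree_eq: "scaling_degree r T = Inf (ereal ` scaling_exponents r T)"
  by (simp add: scaling_degree_def scaling_exponents_def)

lemma deg_add_2_eq: "deg r T + 2 = scaling_degree r T"
  unfolding deg_def by (cases "scaling_degree r T") auto

lemma scaling_exponents_upward:
  assumes "k \<in> scaling_exponents r T" "k \<le> k'"
  shows "k' \<in> scaling_exponents r T"
  unfolding scaling_exponents_def
proof (intro CollectI ballI)
  fix \<phi> :: "real^2 \<Rightarrow> 'a" assume \<phi>: "\<phi> \<in> test_fun (ball 0 r)"
  then have "((\<lambda>l. l powr k * T (rescale l \<phi>)) \<longlongrightarrow> 0) (at_right 0)"
    using assms(1) by (simp add: scaling_exponents_def)
  then show "((\<lambda>l. l powr k' * T (rescale l \<phi>)) \<longlongrightarrow> 0) (at_right 0)"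
  proof (rule tendsto_0_le[where K=1])
    show "\<forall>\<^sub>F l in at_right 0. norm (l powr k' * T (rescale l \<phi>)) \<le> norm (l powr k * T (rescale l \<phi>)) * 1"
      using eventually_at_right_real[of 0 1, simplified]
    proof eventually_elim
      case (elim l)
      have "l powr k' \<le> l powr k"
        using elim assms(2) by (intro powr_mono') auto
      then show ?case
        by (simp add: abs_mult mult_right_mono)
    qed
  qed
qed

lemma scaling_degree_lessD:
  assumes "scaling_degree r T < ereal c"
  obtains k where "k \<in> scaling_exponents r T" "k < c"
  using assms by (auto simp: scaling_degree_eq Inf_less_iff)

lemma rescale_eq: "rescale l \<phi> = (\<lambda>x. (1 / l\<^sup>2) *\<^sub>R \<phi> ((1 / l) *\<^sub>R x))"
  by (simp add: rescale_def fun_eq_iff)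

lemma smooth_on_rescale: "smooth_on UNIV \<phi> \<Longrightarrow> smooth_on UNIV (rescale l \<phi>)"
  unfolding rescale_eq
  by (intro smooth_on_bounded_linear[OF open_UNIV bounded_linear_scaleR_right] smooth_on_scaled_argument)

lemma test_fun_rescale:
  assumes "\<phi> \<in> test_fun (ball 0 r)" "0 < l" "l < 1"
  shows "rescale l \<phi> \<in> test_fun (ball 0 r)"
proof (rule test_funI[of _ "(\<lambda>x. l *\<^sub>R x) ` supp \<phi>"])
  show "compact ((\<lambda>x. l *\<^sub>R x) ` supp \<phi>)"
    by (rule compact_scaling[OF test_funD(2)[OF assms(1)]])
  show "(\<lambda>x. l *\<^sub>R x) ` supp \<phi> \<subseteq> ball 0 r"
  proof (rule image_subsetI)
    fix x assume "x \<in> supp \<phi>"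
    then have "norm x < r" using test_funD(3)[OF assms(1)] by auto
    moreover have "l * norm x \<le> norm x"
      using assms by (simp add: mult_left_le_one_le)
    ultimately show "l *\<^sub>R x \<in> ball 0 r" using assms by simp
  qed
  show "rescale l \<phi> x = 0" if "x \<notin> (\<lambda>x. l *\<^sub>R x) ` supp \<phi>" for x
  proof -
    have "(1 / l) *\<^sub>R x \<notin> supp \<phi>"
    proof
      assume "(1 / l) *\<^sub>R x \<in> supp \<phi>"
      from imageI[OF this, of "\<lambda>x. l *\<^sub>R x"] that assms show False by simp
    qed
    then show ?thesis by (simp add: rescale_def zero_outside_supp)
  qed
qed (use smooth_on_rescale[OF test_funD(1)[OF assms(1)]] in auto)

lemma pd_rescale:
  assumes "smooth_on UNIV \<phi>"
  shows "pd i (rescale l \<phi>) = (\<lambda>x. (1 / l) *\<^sub>R rescale l (pd i \<phi>) x)"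
proof
  fix x
  have d: "\<phi> differentiable (at x)" for x
    using assms by (rule smooth_on_differentiable) simp
  have d': "(\<lambda>x. \<phi> ((1 / l) *\<^sub>R x)) differentiable (at x)"
    using smooth_on_scaled_argument[OF assms] by (rule smooth_on_differentiable) simp
  show "pd i (rescale l \<phi>) x = (1 / l) *\<^sub>R rescale l (pd i \<phi>) x"
    unfolding rescale_eq pd_bounded_linear[OF bounded_linear_scaleR_right d'] pd_scaled_argument[OF d]
    by (simp add: mult.commute)
qed

lemma foldr_pd_rescale:
  fixes \<phi> :: "real^2 \<Rightarrow> real"
  assumes "smooth_on UNIV \<phi>"
  shows "foldr pd is (rescale l \<phi>) = (\<lambda>x. (1 / l) ^ length is * rescale l (foldr pd is \<phi>) x)"
proof (induction "is")
  case (Cons i "is")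
  have "smooth_on UNIV (foldr pd is \<phi>)"
    by (rule smooth_on_foldr_pd[OF assms])
  then show ?case
    using Cons by (simp add: smooth_pd_cmult smooth_on_rescale pd_rescale mult_ac)
qed simp

lemma mpd_rescale_at_origin:
  fixes \<phi> :: "real^2 \<Rightarrow> real"
  assumes "smooth_on UNIV \<phi>"
  shows "mpd \<beta> (rescale l \<phi>) 0 = (1 / l) ^ (mi_abs \<beta> + 2) * mpd \<beta> \<phi> 0"
  unfolding mpd_eq_foldr foldr_pd_rescale[OF assms]
  by (simp add: rescale_def mi_abs_def power_add power_divide power2_eq_square)

text \<open>Localise \<open>w \<alpha>\<close> to the ball of radius \<open>r\<close> by a cutoff equal to \<open>1\<close> near the origin.
  All its derivatives at the origin but the one of index \<open>\<alpha>\<close> vanish, so the expansion shows that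
  rescaling multiplies the value of \<open>T\<close> by exactly \<open>l powr - (2 + mi_abs \<alpha>)\<close>. Unless \<open>T (w \<alpha>)\<close>
  is zero, no factor \<open>l powr k\<close> with \<open>k < mi_abs \<alpha> + 2\<close> can make this tend to zero.\<close>

lemma eq_0_by_scaling:
  assumes lin: "linear_on_tests U T" and away: "\<And>\<phi>. \<phi> \<in> test_fun (U - {0}) \<Longrightarrow> T \<phi> = 0"
    and ord: "order_at_most m U (cball 0 \<rho>) T" and \<rho>: "\<rho> > 0"
    and w: "\<And>\<alpha>. w \<alpha> \<in> test_fun U"
      "\<And>\<alpha> \<beta>. mpd \<beta> (w \<alpha>) 0 = (if \<beta> = \<alpha> then (-1) ^ mi_abs \<alpha> else 0)"
    and r: "r > 0" "ball 0 r \<subseteq> U"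
    and k: "k \<in> scaling_exponents r T" "k < mi_abs \<alpha> + 2" and \<alpha>: "mi_abs \<alpha> \<le> m"
  shows "T (w \<alpha>) = 0"
proof -
  obtain \<eta> :: "real^2 \<Rightarrow> real" where \<eta>: "smooth_on UNIV \<eta>" "\<And>y. 0 \<le> \<eta> y"
    "\<And>y. dist 0 y \<le> r/3 \<Longrightarrow> \<eta> y = 1" "\<And>y. r/2 \<le> dist 0 y \<Longrightarrow> \<eta> y = 0"
    using exists_cutoff[of "r/3" "r/2" 0] r by auto
  define \<phi> where "\<phi> x = \<eta> x * w \<alpha> x" for x
  have sm: "smooth_on UNIV \<phi>"
    unfolding \<phi>_def by (rule smooth_on_mult[OF open_UNIV \<eta>(1) test_funD(1)[OF w(1)]])
  have \<phi>: "\<phi> \<in> test_fun (ball 0 r)"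
    by (rule test_funI[OF sm, of "cball 0 (r/2)"]) (use r \<eta>(4) in \<open>auto simp: \<phi>_def\<close>)
  have "mpd \<beta> \<phi> 0 = mpd \<beta> (w \<alpha>) 0" for \<beta>
    unfolding mpd_eq_foldr
    by (rule foldr_pd_cong_open[of "ball 0 (r/3)"]) (use r \<eta>(3) in \<open>auto simp: \<phi>_def\<close>)
  then have deriv: "mpd \<beta> \<phi> 0 = (if \<beta> = \<alpha> then (-1) ^ mi_abs \<alpha> else 0)" for \<beta>
    by (simp add: w(2))
  have T: "T (rescale l \<phi>) = (1 / l) ^ (mi_abs \<alpha> + 2) * T (w \<alpha>)" if "0 < l" "l < 1" for l
  proof -
    have "rescale l \<phi> \<in> test_fun U"
      using test_fun_mono[OF test_fun_rescale[OF \<phi> that] r(2)] .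
    from expansion_at_origin[OF lin away ord \<rho> w this]
    have "T (rescale l \<phi>) = (\<Sum>\<beta> | mi_abs \<beta> \<le> m. if \<beta> = \<alpha> then (1 / l) ^ (mi_abs \<alpha> + 2) * T (w \<alpha>) else 0)"
      unfolding mpd_rescale_at_origin[OF sm] deriv
      by (simp add: if_distrib if_distribR mult_ac flip: power_add mult_2 cong: if_cong sum.cong)
    then show ?thesis
      using finite_mi_abs_le[of m] \<alpha> by (simp add: sum.delta')
  qed
  have "((\<lambda>l. l powr k * T (rescale l \<phi>)) \<longlongrightarrow> 0) (at_right 0)"
    using k(1) \<phi> by (simp add: scaling_exponents_def)
  then have "((\<lambda>l. T (w \<alpha>)) \<longlongrightarrow> 0) (at_right (0::real))"
  proof (rule tendsto_0_le[where K=1])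
    show "\<forall>\<^sub>F l in at_right 0. norm (T (w \<alpha>)) \<le> norm (l powr k * T (rescale l \<phi>)) * 1"
      using eventually_at_right_real[of 0 1, simplified]
    proof eventually_elim
      case (elim l)
      then have l: "0 < l" "l < 1" by auto
      have "l ^ (mi_abs \<alpha> + 2) = l powr (mi_abs \<alpha> + 2)"
        using l powr_realpow[of l "mi_abs \<alpha> + 2"] by simp
      also have "\<dots> \<le> l powr k"
        using l k(2) by (intro powr_mono') auto
      finally have "1 \<le> l powr k * (1 / l) ^ (mi_abs \<alpha> + 2)"
        using l by (simp add: power_divide field_simps)
      from mult_right_mono[OF this, of "\<bar>T (w \<alpha>)\<bar>"] show ?case
        using l by (simp add: T abs_mult mult.assoc)
    qed
  qed
  then show ?thesis by (simp add: tendsto_const_iff)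
qed

section \<open>The incompatibility operator\<close>

lemma test_fun_component:
  fixes \<Phi> :: "real^2 \<Rightarrow> real^2^2"
  assumes "\<Phi> \<in> test_fun U"
  shows "(\<lambda>x. \<Phi> x $ i $ j) \<in> test_fun U"
  by (rule test_fun_bounded_linear[OF _ assms])
    (rule bounded_linear_compose[OF bounded_linear_vec_nth bounded_linear_vec_nth])

lemma test_fun_tensorI:
  fixes \<Phi> :: "real^2 \<Rightarrow> real^2^2"
  assumes "\<And>i j. (\<lambda>x. \<Phi> x $ i $ j) \<in> test_fun U"
  shows "\<Phi> \<in> test_fun U"
proof -
  have "\<Phi> = (\<lambda>x. \<Sum>i\<in>UNIV. \<Sum>j\<in>UNIV. (\<Phi> x $ i $ j) *\<^sub>R axis i (axis j 1))"
    by (simp add: fun_eq_iff sum_2 vec_eq_iff forall_2 axis_def)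
  moreover have "(\<lambda>x. \<Sum>i\<in>UNIV. \<Sum>j\<in>UNIV. (\<Phi> x $ i $ j) *\<^sub>R axis i (axis j 1) :: real^2^2) \<in> test_fun U"
    by (intro test_fun_sum test_fun_bounded_linear[OF bounded_linear_scaleR_left] assms)
  ultimately show ?thesis by simp
qed

lemma test_fun_bbA_hessian:
  assumes "\<phi> \<in> test_fun U"
  shows "(\<lambda>x. bbA (hessian \<phi> x)) \<in> test_fun U"
proof (rule test_fun_tensorI)
  fix i j :: 2
  have pd: "(\<lambda>x. c * pd k (pd l \<phi>) x) \<in> test_fun U" for c k l
    using test_fun_cmult[OF test_fun_pd[OF test_fun_pd[OF assms]]] .
  from pd[of 1] pd[of "-1"] show "(\<lambda>x. bbA (hessian \<phi> x) $ i $ j) \<in> test_fun U"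
    using exhaust_2[of i] exhaust_2[of j] by (auto simp: bbA_components hessian_def)
qed

text \<open>The distributional \<open>Curl Curl\<close> is the adjoint of \<open>\<phi> \<mapsto> \<bbbA>\<nabla>\<^sup>2\<phi>\<close>. The map \<open>\<bbbA>\<close> puts the mixed
  derivatives in transposed positions, which the symmetry of \<open>E\<close> undoes.\<close>

lemma tensor_apply_bbA_hessian:
  assumes "E \<in> \<A>_Sym U" "\<phi> \<in> test_fun U"
  shows "tensor_apply E (\<lambda>x. bbA (hessian \<phi> x)) = Curl (Curl_tensor E) \<phi>"
proof -
  have lin: "linear_on_tests U (E$i$j)" for i j
    using assms(1) linear_on_tests_\<A> by (simp add: \<A>_Sym_def)
  have pd: "pd k (pd l \<phi>) \<in> test_fun U" for k l
    by (intro test_fun_pd assms)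
  have minus: "(E$i$j) (\<lambda>x. - pd k (pd l \<phi>) x) = - (E$i$j) (pd k (pd l \<phi>))" for i j k l
    using linear_on_tests_cmult[OF lin[of i j] pd[of k l], of "-1"] by simp
  have "(E$1$2) (pd 2 (pd 1 \<phi>)) = (E$2$1) (pd 2 (pd 1 \<phi>))" "(E$1$2) (pd 1 (pd 2 \<phi>)) = (E$2$1) (pd 1 (pd 2 \<phi>))"
    using assms(1) pd by (simp_all add: \<A>_Sym_def)
  then show ?thesis
    by (simp add: tensor_apply_def sum_2 bbA_components hessian_def Curl_Curl_eq minus)
qed

lemma tensor_apply_scaleR:
  fixes \<Phi> :: "real^2 \<Rightarrow> real^2^2"
  assumes "\<And>i j. linear_on_tests U (E$i$j)" "\<Phi> \<in> test_fun U"
  shows "tensor_apply E (\<lambda>x. c *\<^sub>R \<Phi> x) = c * tensor_apply E \<Phi>"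
  using linear_on_tests_cmult[OF assms(1) test_fun_component[OF assms(2)]]
  by (simp add: tensor_apply_def sum_distrib_left)

lemma bbA_hessian_rescale:
  assumes "smooth_on UNIV \<phi>"
  shows "bbA (hessian (rescale l \<phi>) x) = (1 / l\<^sup>2) *\<^sub>R rescale l (\<lambda>x. bbA (hessian \<phi> x)) x"
proof -
  have "pd i (pd j (rescale l \<phi>)) = (\<lambda>x. (1 / l\<^sup>2) * rescale l (pd i (pd j \<phi>)) x)" for i j
    using foldr_pd_rescale[OF assms, of "[i, j]" l] by (simp add: power2_eq_square)
  then show ?thesis
    by (simp add: vec_eq_iff forall_2 bbA_components hessian_def rescale_def)
qed

text \<open>The two derivatives in the Hessian of a rescaled function produce the factor \<open>1 / l\<^sup>2\<close>.\<close>

lemma scaling_exponents_Curl_Curl: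
  assumes E: "E \<in> \<A>_Sym \<Omega>" and r: "ball 0 r \<subseteq> \<Omega>" and k: "k \<in> scaling_exponents r (tensor_apply E)"
  shows "k + 2 \<in> scaling_exponents r (Curl (Curl_tensor E))"
  unfolding scaling_exponents_def
proof (intro CollectI ballI)
  fix \<phi> :: "real^2 \<Rightarrow> real" assume \<phi>: "\<phi> \<in> test_fun (ball 0 r)"
  let ?\<Phi> = "\<lambda>x. bbA (hessian \<phi> x)"
  have lin: "linear_on_tests \<Omega> (E$i$j)" for i j
    using E linear_on_tests_\<A> by (simp add: \<A>_Sym_def)
  have \<Phi>: "?\<Phi> \<in> test_fun (ball 0 r)"
    by (rule test_fun_bbA_hessian[OF \<phi>])
  have "((\<lambda>l. l powr k * tensor_apply E (rescale l ?\<Phi>)) \<longlongrightarrow> 0) (at_right 0)"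
    using k \<Phi> by (simp add: scaling_exponents_def)
  moreover have "\<forall>\<^sub>F l in at_right 0. l powr k * tensor_apply E (rescale l ?\<Phi>)
      = l powr (k + 2) * Curl (Curl_tensor E) (rescale l \<phi>)"
    using eventually_at_right_real[of 0 1, simplified]
  proof eventually_elim
    case (elim l)
    then have l: "0 < l" "l < 1" by auto
    have "Curl (Curl_tensor E) (rescale l \<phi>) = tensor_apply E (\<lambda>x. bbA (hessian (rescale l \<phi>) x))"
      using tensor_apply_bbA_hessian[OF E test_fun_mono[OF test_fun_rescale[OF \<phi> l] r]] by simp
    also have "\<dots> = (1 / l\<^sup>2) * tensor_apply E (rescale l ?\<Phi>)"
      unfolding bbA_hessian_rescale[OF test_funD(1)[OF \<phi>]]
      using test_fun_mono[OF test_fun_rescale[OF \<Phi> l] r] lin by (intro tensor_apply_scaleR)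
    finally show ?case
      using l by (simp add: powr_add)
  qed
  ultimately show "((\<lambda>l. l powr (k + 2) * Curl (Curl_tensor E) (rescale l \<phi>)) \<longlongrightarrow> 0) (at_right 0)"
    by (rule Lim_transform_eventually)
qed

lemma scaling_exponents_cong:
  assumes "\<And>\<phi>. \<phi> \<in> test_fun (ball 0 r) \<Longrightarrow> S \<phi> = T \<phi>"
  shows "scaling_exponents r S \<subseteq> scaling_exponents r T"
  unfolding scaling_exponents_def
proof (intro Collect_mono impI ballI)
  fix k and \<phi> :: "real^2 \<Rightarrow> 'a"
  assume *: "\<forall>\<phi>\<in>test_fun (ball 0 r). ((\<lambda>l. l powr k * S (rescale l \<phi>)) \<longlongrightarrow> 0) (at_right 0)"
    and \<phi>: "\<phi> \<in> test_fun (ball 0 r)"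
  have "\<forall>\<^sub>F l in at_right 0. l powr k * S (rescale l \<phi>) = l powr k * T (rescale l \<phi>)"
    using eventually_at_right_real[of 0 1, simplified]
    by eventually_elim (use assms test_fun_rescale[OF \<phi>] in auto)
  with *[rule_format, OF \<phi>] show "((\<lambda>l. l powr k * T (rescale l \<phi>)) \<longlongrightarrow> 0) (at_right 0)"
    by (rule Lim_transform_eventually)
qed

lemma scaling_exponents_minus:
  assumes "k \<in> scaling_exponents r S" "k \<in> scaling_exponents r T"
  shows "k \<in> scaling_exponents r (\<lambda>\<phi>. S \<phi> - T \<phi>)"
  unfolding scaling_exponents_def
proof (intro CollectI ballI)
  fix \<phi> :: "real^2 \<Rightarrow> 'a" assume "\<phi> \<in> test_fun (ball 0 r)"
  then have "((\<lambda>l. l powr k * S (rescale l \<phi>) - l powr k * T (rescale l \<phi>)) \<longlongrightarrow> 0 - 0) (at_right 0)"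
    using assms by (intro tendsto_diff) (auto simp: scaling_exponents_def)
  then show "((\<lambda>l. l powr k * (S (rescale l \<phi>) - T (rescale l \<phi>))) \<longlongrightarrow> 0) (at_right 0)"
    by (simp add: right_diff_distrib)
qed

lemma deg_le_of_incompatibility:
  assumes E: "E \<in> \<A>_Sym \<Omega>" and r: "ball 0 r \<subseteq> \<Omega>"
    and eq: "\<And>\<phi>. \<phi> \<in> test_fun \<Omega> \<Longrightarrow> Curl (Curl_tensor E) \<phi> = N \<phi>"
  shows "deg r N \<le> deg r (tensor_apply E) + 2"
proof -
  have "scaling_degree r N \<le> ereal (k + 2)" if "k \<in> scaling_exponents r (tensor_apply E)" for k
  proof -
    have "k + 2 \<in> scaling_exponents r N"
      using scaling_exponents_Curl_Curl[OF E r that]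
        scaling_exponents_cong[of r "Curl (Curl_tensor E)" N] eq test_fun_mono[OF _ r] by blast
    then show ?thesis
      unfolding scaling_degree_eq by (intro Inf_lower) auto
  qed
  then have "deg r N \<le> ereal k" if "k \<in> scaling_exponents r (tensor_apply E)" for k
    using that unfolding deg_def by (cases "scaling_degree r N") force+
  then show ?thesis
    unfolding deg_add_2_eq unfolding scaling_degree_eq[of r "tensor_apply E"]
    by (intro Inf_greatest) auto
qed

lemma order_at_most_Curl_Curl:
  assumes "\<And>i j. order_at_most m U K (E$i$j)"
  shows "order_at_most (m + 2) U K (Curl (Curl_tensor E))"
  unfolding Curl_Curl_eq[abs_def] add_2_eq_Suc'
  by (intro order_at_most_plus order_at_most_minus order_at_most_pd[where T="\<lambda>\<phi>. S (pd i \<phi>)" for S i]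
      order_at_most_pd assms)

lemma incompatibility_order_at_most:
  assumes E: "\<And>i j. distribution_on U (E$i$j)" and N: "distribution_on U N" and K: "compact K" "K \<subseteq> U"
  obtains m where "order_at_most m U K (\<lambda>\<phi>. Curl (Curl_tensor E) \<phi> - N \<phi>)"
proof -
  have "\<exists>m. order_at_most m U K (E$i$j)" for i j
    using distribution_order_at_most[OF E K] by metis
  then obtain m where m: "\<And>i j. order_at_most (m i j) U K (E$i$j)" by metis
  obtain n where n: "order_at_most n U K N"
    using distribution_order_at_most[OF N K] .
  let ?M = "n + (\<Sum>i\<in>UNIV. \<Sum>j\<in>UNIV. m i j)"
  have "m i j \<le> ?M" for i j
    using exhaust_2[of i] exhaust_2[of j] by (auto simp: sum_2)
  then have "order_at_most (?M + 2) U K (Curl (Curl_tensor E))"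
    by (intro order_at_most_Curl_Curl order_at_most_mono[OF m])
  moreover have "order_at_most (?M + 2) U K N"
    by (rule order_at_most_mono[OF n]) simp
  ultimately show ?thesis
    using that order_at_most_minus by blast
qed

section \<open>Equivalence of the incompatibility conditions\<close>

theorem lemma4p8:
  fixes \<Omega> :: "(real^2) set" and E :: "dist^2^2" and N :: dist
    and r :: real and w :: "multi_index \<Rightarrow> real^2 \<Rightarrow> real"
  assumes "open \<Omega>" and "bounded \<Omega>" and "simply_connected \<Omega>" and "0 \<in> \<Omega>"
    and "E \<in> \<A>_Sym \<Omega>" and "N \<in> \<A> \<Omega>"
    and "r > 0" and "ball 0 r \<subseteq> \<Omega>"
    and "\<And>\<alpha>. w \<alpha> \<in> test_fun \<Omega>"
    and "\<And>\<alpha> \<beta>. mpd \<beta> (w \<alpha>) 0 = (if \<beta> = \<alpha> then (-1) ^ mi_abs \<alpha> else 0)"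
  shows "(\<forall>\<phi>\<in>test_fun \<Omega>. Curl (Curl_tensor E) \<phi> = N \<phi>) \<longleftrightarrow>
    (\<forall>x\<in>\<Omega> - {0}. curl (curl_tensor (smooth_rep_tensor (\<Omega> - {0}) E)) x = smooth_rep (\<Omega> - {0}) N x) \<and>
    (\<forall>\<alpha>. ereal (real (mi_abs \<alpha>)) \<le> deg r (tensor_apply E) + 2 \<longrightarrow>
      tensor_apply E (\<lambda>x. bbA (hessian (w \<alpha>) x)) = N (w \<alpha>)) \<and>
    deg r N \<le> deg r (tensor_apply E) + 2"
    (is "?eq \<longleftrightarrow> ?i \<and> ?ii \<and> ?iii")
proof -
  have E: "E$i$j \<in> \<A> \<Omega>" for i j
    using assms(5) by (simp add: \<A>_Sym_def)
  have i: "?i \<longleftrightarrow> (\<forall>\<phi>\<in>test_fun (\<Omega> - {0}). Curl (Curl_tensor E) \<phi> = N \<phi>)"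
    by (rule classical_incompatibility_iff[OF assms(1) E assms(6)])
  have w: "tensor_apply E (\<lambda>x. bbA (hessian (w \<alpha>) x)) = Curl (Curl_tensor E) (w \<alpha>)" for \<alpha>
    by (rule tensor_apply_bbA_hessian[OF assms(5,9)])
  show ?thesis
  proof
    assume eq: ?eq
    then have "\<forall>\<phi>\<in>test_fun (\<Omega> - {0}). Curl (Curl_tensor E) \<phi> = N \<phi>"
      using test_fun_mono[of _ "\<Omega> - {0}" \<Omega>] by blast
    moreover have ?ii
      using eq assms(9) by (simp add: w)
    moreover have ?iii
      using eq by (intro deg_le_of_incompatibility[OF assms(5,8)]) blast
    ultimately show "?i \<and> ?ii \<and> ?iii"
      using i by blast
  next
    assume conds: "?i \<and> ?ii \<and> ?iii"
    define T where "T \<phi> = Curl (Curl_tensor E) \<phi> - N \<phi>" for \<phi>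
    have lin: "linear_on_tests \<Omega> T"
      unfolding T_def[abs_def] by (intro linear_on_tests_minus linear_on_tests_Curl_Curl linear_on_tests_\<A> E assms(6))
    have away: "T \<phi> = 0" if "\<phi> \<in> test_fun (\<Omega> - {0})" for \<phi>
      using conds that unfolding i T_def by simp
    let ?K = "cball 0 (r/2) :: (real^2) set"
    have K: "compact ?K" "?K \<subseteq> \<Omega>" "r / 2 > 0"
      using assms(7,8) by (auto intro!: subset_trans[OF _ assms(8)])
    obtain m where ord: "order_at_most m \<Omega> ?K T"
      using incompatibility_order_at_most[of \<Omega> E N, OF _ _ K(1,2)] E assms(6)
      unfolding T_def[abs_def] \<A>_def by blast
    have zero: "T (w \<alpha>) = 0" if \<alpha>: "mi_abs \<alpha> \<le> m" for \<alpha>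
    proof (cases "ereal (real (mi_abs \<alpha>)) \<le> deg r (tensor_apply E) + 2")
      case True
      then have "tensor_apply E (\<lambda>x. bbA (hessian (w \<alpha>) x)) = N (w \<alpha>)"
        using conds by blast
      then show ?thesis
        by (simp add: w T_def)
    next
      case False
      then have lt: "deg r (tensor_apply E) + 2 < ereal (mi_abs \<alpha>)" by simp
      then have "scaling_degree r (tensor_apply E) < ereal (mi_abs \<alpha>)"
        unfolding deg_add_2_eq .
      then obtain k where k: "k \<in> scaling_exponents r (tensor_apply E)" "k < mi_abs \<alpha>"
        by (rule scaling_degree_lessD)
      have "deg r N < ereal (mi_abs \<alpha>)"
        using conds lt by (meson order.strict_trans1)
      then have "scaling_degree r N < ereal (mi_abs \<alpha> + 2)"
        unfolding deg_def by (cases "scaling_degree r N") auto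
      then obtain k' where k': "k' \<in> scaling_exponents r N" "k' < mi_abs \<alpha> + 2"
        by (rule scaling_degree_lessD)
      \<comment> \<open>\<open>k + 2\<close> works for \<open>Curl Curl E\<close>, \<open>k'\<close> for \<open>N\<close>, and both lie below \<open>mi_abs \<alpha> + 2\<close>\<close>
      have "max (k + 2) k' \<in> scaling_exponents r T"
        unfolding T_def[abs_def]
        by (intro scaling_exponents_minus)
          (use scaling_exponents_Curl_Curl[OF assms(5,8) k(1)] k'(1) in
            \<open>auto intro: scaling_exponents_upward\<close>)
      moreover have "max (k + 2) k' < mi_abs \<alpha> + 2"
        using k(2) k'(2) by auto
      ultimately show ?thesis
        using eq_0_by_scaling[OF lin away ord K(3) assms(9,10,7,8)] \<alpha> by blast
    qed
    show ?eq
    proof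
      fix \<phi> :: "real^2 \<Rightarrow> real" assume "\<phi> \<in> test_fun \<Omega>"
      from expansion_at_origin[OF lin away ord K(3) assms(9,10) this]
      have "T \<phi> = 0" by (simp add: zero)
      then show "Curl (Curl_tensor E) \<phi> = N \<phi>" by (simp add: T_def)
    qed
  qed
qed

end
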